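(* Let $n$ be a positive integer, $N=n^2$, $\sigma>0$, $\theta^* \in \mathbb{R}^{n\times n}$, and observe $y = \theta^* + \sigma Z$ where $Z$ has i.i.d. standard normal entries. Let $k = k(\theta^* )$ and let $R_1,\dots,R_k$ be the rectangular level sets of $\theta^*$ forming a partition of $[n]\times[n]$ (a minimal partition into rectangles on each of which $\theta^*$ is constant). Assume there is a constant $c>0$ with $\max_{i\in[k]} A(R_i) \le c$. Then, with $\mathbf{V}^* = \mathrm{TV}_{\mathrm{norm}}(\theta^* )$, $$\mathrm{MSE}(\hat\theta_{\mathbf{V}^*},\theta^* ) \leq C \sigma^2 (\log (e n))^{9} \frac{k(\theta^* )^{5/4}}{N^{3/4}},$$ where $C$ is a constant depending only on $c$.
   Context: $L_n$ is the $n\times n$ grid graph on $[n]\times[n]$ with edge set $E_n$ (pairs at $\ell_1$-distance 1). $\mathrm{TV}_{\mathrm{norm}}(\theta) = \frac{1}{n}\sum_{(u,v)\in E_n}|\theta_u - \theta_v|$. The constrained TVD estimator is $\hat\theta_{\mathbf{V}} = \operatorname{argmin}_{\theta: \mathrm{TV}_{\mathrm{norm}}(\theta)\le \mathbf{V}} \|y - \theta\|^2$ (Frobenius norm), and $\mathrm{MSE}(\hat\theta,\theta^* ) = \mathbb{E}\|\hat\theta - \theta^*\|^2/N$. A (axis-aligned) rectangle is a set $R = ([a,b]\cap\mathbb{N})\times([c',d]\cap\mathbb{N}) \subseteq [n]\times[n]$; $\mathrm{nrow}(R)$ and $\mathrm{ncol}(R)$ are its numbers of rows and columns and its aspect ratio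 is $A(R) = \max\{\mathrm{nrow}(R)/\mathrm{ncol}(R), \mathrm{ncol}(R)/\mathrm{nrow}(R)\}$. $k(\theta)$ is the cardinality of a minimal partition of $[n]\times[n]$ into rectangles on each of which $\theta$ is constant. *)

theory Defs
  imports "HOL-Probability.Probability"
begin

(* Grid [n] x [n]; pixel (i,j) with i = row, j = column. *)
definition grid :: "nat \<Rightarrow> (nat \<times> nat) set" where
  "grid n = {1..n} \<times> {1..n}"

(* Sum over the edge set E_n of the grid graph: each edge {u,v} counted once,
   split into horizontal edges ((i,j),(i,j+1)) and vertical edges ((i,j),(i+1,j)). *)
definition TV_norm :: "nat \<Rightarrow> (nat \<times> nat \<Rightarrow> real) \<Rightarrow> real" where
  "TV_norm n \<theta> = (1 / real n) *
     ((\<Sum>i\<in>{1..n}. \<Sum>j\<in>{1..<n}. \<bar>\<theta> (i, j+1) - \<theta> (i, j)\<bar>) +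
      (\<Sum>i\<in>{1..<n}. \<Sum>j\<in>{1..n}. \<bar>\<theta> (i+1, j) - \<theta> (i, j)\<bar>))"

definition sq_err :: "nat \<Rightarrow> (nat \<times> nat \<Rightarrow> real) \<Rightarrow> (nat \<times> nat \<Rightarrow> real) \<Rightarrow> real" where
  "sq_err n a b = (\<Sum>p\<in>grid n. (a p - b p)\<^sup>2)"

(* feasible set of the constrained TVD estimator (arrays on the grid, extended by 0) *)
definition tv_ball :: "nat \<Rightarrow> real \<Rightarrow> (nat \<times> nat \<Rightarrow> real) set" where
  "tv_ball n V = {\<theta>. (\<forall>p. p \<notin> grid n \<longrightarrow> \<theta> p = 0) \<and> TV_norm n \<theta> \<le> V}"

(* constrained TVD estimator: the (unique) least-squares minimizer over tv_ball *)
definition tvd_est :: "nat \<Rightarrow> real \<Rightarrow> (nat \<times> nat \<Rightarrow> real) \<Rightarrow> (nat \<times> nat \<Rightarrow> real)" where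
  "tvd_est n V y = (SOME \<theta>. \<theta> \<in> tv_ball n V \<and>
      (\<forall>\<theta>' \<in> tv_ball n V. sq_err n y \<theta> \<le> sq_err n y \<theta>'))"

definition gauss_noise :: "nat \<Rightarrow> (nat \<times> nat \<Rightarrow> real) measure" where
  "gauss_noise n = PiM (grid n) (\<lambda>_. density lborel std_normal_density)"

definition MSE :: "nat \<Rightarrow> real \<Rightarrow> real \<Rightarrow> (nat \<times> nat \<Rightarrow> real) \<Rightarrow> ennreal" where
  "MSE n V \<sigma> \<theta> =
     (\<integral>\<^sup>+ Z. ennreal (sq_err n (tvd_est n V (\<lambda>p. \<theta> p + \<sigma> * Z p)) \<theta>) \<partial>gauss_noise n)
       / ennreal (real (n\<^sup>2))"

definition is_rect :: "nat \<Rightarrow> (nat \<times> nat) set \<Rightarrow> bool" where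
  "is_rect n R \<longleftrightarrow> (\<exists>a b c d. 1 \<le> a \<and> a \<le> b \<and> b \<le> n \<and> 1 \<le> c \<and> c \<le> d \<and> d \<le> n \<and>
                         R = {a..b} \<times> {c..d})"

definition nrow :: "(nat \<times> nat) set \<Rightarrow> nat" where "nrow R = card (fst ` R)"
definition ncol :: "(nat \<times> nat) set \<Rightarrow> nat" where "ncol R = card (snd ` R)"

definition aspect :: "(nat \<times> nat) set \<Rightarrow> real" where
  "aspect R = max (real (nrow R) / real (ncol R)) (real (ncol R) / real (nrow R))"

definition rect_partition :: "nat \<Rightarrow> (nat \<times> nat) set set \<Rightarrow> bool" where
  "rect_partition n P \<longleftrightarrow> finite P \<and> (\<forall>R\<in>P. is_rect n R) \<and> pairwise disjnt P \<and> \<Union>P = grid n"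

definition const_on :: "(nat \<times> nat \<Rightarrow> real) \<Rightarrow> (nat \<times> nat) set \<Rightarrow> bool" where
  "const_on \<theta> R \<longleftrightarrow> (\<forall>p\<in>R. \<forall>q\<in>R. \<theta> p = \<theta> q)"

definition k_rect :: "nat \<Rightarrow> (nat \<times> nat \<Rightarrow> real) \<Rightarrow> nat" where
  "k_rect n \<theta> = Min {card P | P. rect_partition n P \<and> (\<forall>R\<in>P. const_on \<theta> R)}"

end

theory Submission
  imports Defs
begin

text \<open>Let \<open>\<delta>\<close> be the estimation error. Minimality gives \<open>\<parallel>\<delta>\<parallel>\<^sup>2 \<le> 2 \<sigma> \<langle>Z, \<delta>\<rangle>\<close>, and
  \<open>TV (\<theta> + \<delta>) \<le> TV \<theta>\<close> says that, summed over the rectangles of the partition, the interior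
  variation of \<open>\<delta>\<close> plus signed boundary values of \<open>\<delta>\<close> is nonpositive. On a single row or column this
  quantity is at least minus twice the mean of \<open>\<bar>\<delta>\<bar>\<close>, so by the bound on the aspect ratios the total
  excess over these lower bounds is of order \<open>sqrt k * \<parallel>\<delta>\<parallel>\<close>. On a Whitney piece of size \<open>w \<times> u\<close> of a
  rectangle (whose side lengths do not exceed its distances to the sides) the excess controls the vertical
  variation up to \<open>sqrt (u / w) * \<parallel>\<delta>\<parallel>\<close> and the horizontal one up to \<open>sqrt (w / u) * \<parallel>\<delta>\<parallel>\<close>.

  The noise enters only through \<open>M\<close>, the maximum of \<open>\<bar>Z(Q)\<bar> / sqrt (card Q)\<close> over all rectangles \<open>Q\<close>, with
  \<open>E M\<^sup>2\<close> of order \<open>log n\<close>. For \<open>w \<le> u\<close>, cut the piece into blocks of length about \<open>sqrt n\<close>; summation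
  by parts along the rows and then along the columns of each block bounds \<open>\<langle>Z, \<delta>\<rangle>\<close> on the piece by
  \<open>M * n powr (1/4)\<close> times the excess plus the norm. There are \<open>O((log n)\<^sup>2)\<close> pieces per rectangle, which yields
  \<open>\<parallel>\<delta>\<parallel>\<^sup>2 \<lesssim> \<sigma>\<^sup>2 M\<^sup>2 (log n)^4 k sqrt n\<close>.\<close>

section \<open>Summation by parts on rectangles\<close>

definition tv1 :: "(nat \<Rightarrow> real) \<Rightarrow> nat \<Rightarrow> nat \<Rightarrow> real" where
  "tv1 g a b = (\<Sum>i\<in>{a..<b}. \<bar>g (Suc i) - g i\<bar>)"

definition tvh :: "(nat \<Rightarrow> nat \<Rightarrow> real) \<Rightarrow> nat \<Rightarrow> nat \<Rightarrow> nat \<Rightarrow> nat \<Rightarrow> real" where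
  "tvh f a b c d = (\<Sum>i\<in>{a..b}. tv1 (f i) c d)"

definition tvv :: "(nat \<Rightarrow> nat \<Rightarrow> real) \<Rightarrow> nat \<Rightarrow> nat \<Rightarrow> nat \<Rightarrow> nat \<Rightarrow> real" where
  "tvv f a b c d = (\<Sum>j\<in>{c..d}. tv1 (\<lambda>i. f i j) a b)"

definition rsum :: "(nat \<Rightarrow> nat \<Rightarrow> real) \<Rightarrow> nat \<Rightarrow> nat \<Rightarrow> nat \<Rightarrow> nat \<Rightarrow> real" where
  "rsum f a b c d = (\<Sum>i\<in>{a..b}. \<Sum>j\<in>{c..d}. f i j)"

text \<open>The normalisation is the standard deviation of a sum of unit noise over the rectangle.
  This is the only information about the noise that the deterministic estimates use.\<close>

definition rect_bounded :: "real \<Rightarrow> (nat \<Rightarrow> nat \<Rightarrow> real) \<Rightarrow> nat \<Rightarrow> nat \<Rightarrow> nat \<Rightarrow> nat \<Rightarrow> bool" where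
  "rect_bounded M Z a b c d \<longleftrightarrow> (\<forall>p q r s. a \<le> p \<longrightarrow> p \<le> q \<longrightarrow> q \<le> b \<longrightarrow> c \<le> r \<longrightarrow> r \<le> s \<longrightarrow> s \<le> d \<longrightarrow>
     \<bar>rsum Z p q r s\<bar> \<le> M * sqrt (real (Suc q - p) * real (Suc s - r)))"

lemma tv1_nonneg: "0 \<le> tv1 g a b"
  by (simp add: tv1_def sum_nonneg)

lemma tvh_nonneg: "0 \<le> tvh f a b c d"
  by (simp add: tvh_def sum_nonneg tv1_nonneg)

lemma tvv_nonneg: "0 \<le> tvv f a b c d"
  by (simp add: tvv_def sum_nonneg tv1_nonneg)

lemma tv1_mono: "a \<le> p \<Longrightarrow> q \<le> b \<Longrightarrow> tv1 g p q \<le> tv1 g a b"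
  unfolding tv1_def by (rule sum_mono2) auto

lemma tv1_concat: "a \<le> p \<Longrightarrow> p \<le> b \<Longrightarrow> tv1 g a p + tv1 g p b = tv1 g a b"
  unfolding tv1_def by (simp add: sum.atLeastLessThan_concat)

lemma abs_diff_endpoints_le_tv1: "a \<le> b \<Longrightarrow> \<bar>g b - g a\<bar> \<le> tv1 g a b"
proof (induction rule: dec_induct)
  case base
  then show ?case by (simp add: tv1_def)
next
  case (step k)
  then show ?case by (simp add: tv1_def)
qed

lemma abs_diff_le_tv1:
  assumes "i \<in> {a..b}" "j \<in> {a..b}"
  shows "\<bar>g i - g j\<bar> \<le> tv1 g a b"
proof (cases "i \<le> j")
  case True
  with assms abs_diff_endpoints_le_tv1[of i j g] tv1_mono[of a i j b g] show ?thesis by auto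
next
  case False
  with assms abs_diff_endpoints_le_tv1[of j i g] tv1_mono[of a j i b g] show ?thesis by auto
qed

lemma abs_diff_mean_le_tv1:
  assumes "a \<le> b"
  shows "\<bar>g b - (\<Sum>i\<in>{a..b}. g i) / real (Suc b - a)\<bar> \<le> tv1 g a b"
proof -
  let ?m = "real (Suc b - a)"
  have m: "?m > 0" using assms by simp
  have "g b * ?m - (\<Sum>i\<in>{a..b}. g i) = (\<Sum>i\<in>{a..b}. g b - g i)"
    by (simp add: sum_subtractf mult.commute)
  then have "\<bar>g b * ?m - (\<Sum>i\<in>{a..b}. g i)\<bar> \<le> (\<Sum>i\<in>{a..b}. \<bar>g b - g i\<bar>)"
    by simp
  also have "\<dots> \<le> (\<Sum>i\<in>{a..b}. tv1 g a b)"
    by (intro sum_mono abs_diff_le_tv1) (use assms in auto)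
  finally have *: "\<bar>g b * ?m - (\<Sum>i\<in>{a..b}. g i)\<bar> \<le> tv1 g a b * ?m"
    by (simp add: mult.commute)
  have "g b - (\<Sum>i\<in>{a..b}. g i) / ?m = (g b * ?m - (\<Sum>i\<in>{a..b}. g i)) / ?m"
    using m by (simp add: field_simps)
  then show ?thesis using * m by (simp only: abs_divide) (simp add: pos_divide_le_eq)
qed

text \<open>Discrete integration by parts, anchored at the last value of \<open>g\<close>. Moving
  the anchor from \<open>g k\<close> to \<open>g (Suc k)\<close> costs one partial sum of
  \<open>z\<close> times one increment of \<open>g\<close>.\<close>

lemma abel_summation_bound:
  fixes z g :: "nat \<Rightarrow> real"
  assumes "a \<le> b" "\<And>k. a \<le> k \<Longrightarrow> k \<le> b \<Longrightarrow> \<bar>\<Sum>i\<in>{a..k}. z i\<bar> \<le> B"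
  shows "\<bar>(\<Sum>i\<in>{a..b}. z i * g i) - (\<Sum>i\<in>{a..b}. z i) * g b\<bar> \<le> B * tv1 g a b"
  using assms
proof (induction rule: dec_induct)
  case base
  then show ?case by (simp add: tv1_def)
next
  case (step k)
  have IH: "\<bar>(\<Sum>i\<in>{a..k}. z i * g i) - (\<Sum>i\<in>{a..k}. z i) * g k\<bar> \<le> B * tv1 g a k"
    using step by auto
  have "(\<Sum>i\<in>{a..Suc k}. z i * g i) - (\<Sum>i\<in>{a..Suc k}. z i) * g (Suc k) =
     ((\<Sum>i\<in>{a..k}. z i * g i) - (\<Sum>i\<in>{a..k}. z i) * g k) - (\<Sum>i\<in>{a..k}. z i) * (g (Suc k) - g k)"
    using step by (simp add: algebra_simps)
  moreover have "\<bar>(\<Sum>i\<in>{a..k}. z i) * (g (Suc k) - g k)\<bar> \<le> B * \<bar>g (Suc k) - g k\<bar>"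
    using step by (simp add: abs_mult mult_right_mono)
  moreover have "tv1 g a (Suc k) = tv1 g a k + \<bar>g (Suc k) - g k\<bar>"
    using step by (simp add: tv1_def)
  ultimately show ?case using IH by (simp add: distrib_left)
qed

lemma abs_diff_chain:
  fixes x y z :: real
  shows "\<bar>x - y\<bar> \<le> p \<Longrightarrow> \<bar>y - z\<bar> \<le> q \<Longrightarrow> \<bar>x - z\<bar> \<le> p + q"
  by linarith

text \<open>The last value of \<open>g\<close> lies within \<open>tv1 g a b\<close> of the mean, so
  anchoring at the mean costs the same error once more. Means are the better anchor because their
  variation in the other direction is an average of variations.\<close>

lemma abel_mean_bound:
  fixes z g :: "nat \<Rightarrow> real"
  assumes "a \<le> b" "\<And>k. a \<le> k \<Longrightarrow> k \<le> b \<Longrightarrow> \<bar>\<Sum>i\<in>{a..k}. z i\<bar> \<le> B"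
  shows "\<bar>(\<Sum>i\<in>{a..b}. z i * g i) - (\<Sum>i\<in>{a..b}. z i) * ((\<Sum>i\<in>{a..b}. g i) / real (Suc b - a))\<bar>
    \<le> 2 * B * tv1 g a b"
proof -
  let ?v = "(\<Sum>i\<in>{a..b}. g i) / real (Suc b - a)"
  have "\<bar>(\<Sum>i\<in>{a..b}. z i) * (g b - ?v)\<bar> \<le> B * tv1 g a b"
    unfolding abs_mult
  proof (rule mult_mono)
    show "\<bar>\<Sum>i\<in>{a..b}. z i\<bar> \<le> B" using assms by simp
    then show "0 \<le> B" using abs_ge_zero order_trans by blast
  qed (use abs_diff_mean_le_tv1[OF assms(1)] in auto)
  then have "\<bar>(\<Sum>i\<in>{a..b}. z i) * g b - (\<Sum>i\<in>{a..b}. z i) * ?v\<bar> \<le> B * tv1 g a b"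
    by (simp only: right_diff_distrib)
  from abs_diff_chain[OF abel_summation_bound[OF assms, of g] this] show ?thesis by simp
qed

lemma abs_sum_le_sqrt:
  fixes f :: "'a \<Rightarrow> real"
  assumes "finite A"
  shows "(\<Sum>x\<in>A. \<bar>f x\<bar>) \<le> sqrt (real (card A)) * sqrt (\<Sum>x\<in>A. (f x)\<^sup>2)"
proof -
  have "(\<Sum>x\<in>A. \<bar>f x\<bar> * \<bar>1\<bar>) \<le> L2_set f A * L2_set (\<lambda>_. 1) A"
    using L2_set_mult_ineq[of f "\<lambda>_. 1" A] .
  then show ?thesis by (simp add: L2_set_def mult.commute)
qed

lemma rsum_abs_le_sqrt:
  "rsum (\<lambda>i j. \<bar>f i j\<bar>) a b c d \<le>
    sqrt (real (Suc b - a) * real (Suc d - c)) * sqrt (rsum (\<lambda>i j. (f i j)\<^sup>2) a b c d)"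
  using abs_sum_le_sqrt[of "{a..b} \<times> {c..d}" "\<lambda>(i,j). f i j"]
  by (simp add: rsum_def sum.cartesian_product case_prod_unfold)

lemma abs_rsum_le: "\<bar>rsum f a b c d\<bar> \<le> rsum (\<lambda>i j. \<bar>f i j\<bar>) a b c d"
  unfolding rsum_def by (rule order_trans[OF sum_abs sum_mono]) simp

lemma rsum_swap: "rsum (\<lambda>j i. f i j) c d a b = rsum f a b c d"
  unfolding rsum_def by (rule sum.swap)

lemma rsum_swap_order: "rsum f a b c d = (\<Sum>j\<in>{c..d}. \<Sum>i\<in>{a..b}. f i j)"
  unfolding rsum_def by (rule sum.swap)

lemma rsum_nonneg: "(\<And>i j. 0 \<le> f i j) \<Longrightarrow> 0 \<le> rsum f a b c d"
  by (simp add: rsum_def sum_nonneg)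

lemma rsum_mono_rect:
  assumes "\<And>i j. 0 \<le> f i j" "a \<le> p" "q \<le> b" "c \<le> r" "s \<le> d"
  shows "rsum f p q r s \<le> rsum f a b c d"
proof -
  have "(\<Sum>x\<in>{p..q} \<times> {r..s}. f (fst x) (snd x)) \<le> (\<Sum>x\<in>{a..b} \<times> {c..d}. f (fst x) (snd x))"
    using assms by (intro sum_mono2) auto
  then show ?thesis by (simp add: rsum_def sum.cartesian_product case_prod_unfold)
qed

lemma rect_boundedD:
  assumes "rect_bounded M Z a b c d" "a \<le> p" "p \<le> q" "q \<le> b" "c \<le> r" "r \<le> s" "s \<le> d"
  shows "\<bar>rsum Z p q r s\<bar> \<le> M * sqrt (real (Suc q - p) * real (Suc s - r))"
  using assms unfolding rect_bounded_def by blast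

lemma rect_bounded_mono:
  assumes "rect_bounded M Z a b c d" "a \<le> p" "q \<le> b" "c \<le> r" "s \<le> d"
  shows "rect_bounded M Z p q r s"
  using assms unfolding rect_bounded_def by (meson order_trans)

lemma rect_bounded_swap:
  assumes "rect_bounded M Z a b c d"
  shows "rect_bounded M (\<lambda>j i. Z i j) c d a b"
  unfolding rect_bounded_def rsum_swap[of Z]
  by (intro allI impI, subst mult.commute, rule rect_boundedD[OF assms])

text \<open>Summation by parts is applied twice: in each row around the row mean \<open>F i\<close>,
  then across the rows around the mean of all row means. What is left is the total noise times that
  overall mean.\<close>

lemma block_bound:
  fixes Z f :: "nat \<Rightarrow> nat \<Rightarrow> real"
  assumes ab: "a \<le> b" and cd: "c \<le> d" and M: "0 \<le> M" and Z: "rect_bounded M Z a b c d"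
  defines "w \<equiv> real (Suc b - a)" and "u \<equiv> real (Suc d - c)"
  shows "\<bar>rsum (\<lambda>i j. Z i j * f i j) a b c d\<bar> \<le>
    M * (2 * sqrt u * tvh f a b c d + 2 * sqrt (w / u) * tvv f a b c d
         + sqrt (rsum (\<lambda>i j. (f i j)\<^sup>2) a b c d))"
proof -
  have w: "w \<ge> 1" and u: "u \<ge> 1" using ab cd by (auto simp: w_def u_def)
  define F where "F i = (\<Sum>j\<in>{c..d}. f i j) / u" for i
  define X where "X i = (\<Sum>j\<in>{c..d}. Z i j)" for i
  have row: "\<bar>(\<Sum>j\<in>{c..d}. Z i j * f i j) - X i * F i\<bar> \<le> 2 * (M * sqrt u) * tv1 (f i) c d"
    if i: "i \<in> {a..b}" for i
    unfolding X_def F_def u_def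
  proof (rule abel_mean_bound[OF cd])
    fix k assume k: "c \<le> k" "k \<le> d"
    have "\<bar>rsum Z i i c k\<bar> \<le> M * sqrt (real (Suc i - i) * real (Suc k - c))"
      using i k by (intro rect_boundedD[OF Z]) auto
    also have "\<dots> \<le> M * sqrt (real (Suc d - c))"
      using k M by (intro mult_left_mono) auto
    finally show "\<bar>\<Sum>j\<in>{c..k}. Z i j\<bar> \<le> M * sqrt (real (Suc d - c))"
      by (simp add: rsum_def)
  qed
  have 1: "\<bar>rsum (\<lambda>i j. Z i j * f i j) a b c d - (\<Sum>i\<in>{a..b}. X i * F i)\<bar> \<le> 2 * (M * sqrt u) * tvh f a b c d"
  proof -
    have "\<bar>rsum (\<lambda>i j. Z i j * f i j) a b c d - (\<Sum>i\<in>{a..b}. X i * F i)\<bar>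
      \<le> (\<Sum>i\<in>{a..b}. \<bar>(\<Sum>j\<in>{c..d}. Z i j * f i j) - X i * F i\<bar>)"
      unfolding rsum_def sum_subtractf[symmetric] by (rule sum_abs)
    also have "\<dots> \<le> (\<Sum>i\<in>{a..b}. 2 * (M * sqrt u) * tv1 (f i) c d)"
      by (rule sum_mono[OF row])
    finally show ?thesis by (simp add: tvh_def sum_distrib_left)
  qed
  let ?Fm = "(\<Sum>i\<in>{a..b}. F i) / w"
  have 2: "\<bar>(\<Sum>i\<in>{a..b}. X i * F i) - (\<Sum>i\<in>{a..b}. X i) * ?Fm\<bar> \<le> 2 * (M * sqrt (w * u)) * tv1 F a b"
    unfolding w_def
  proof (rule abel_mean_bound[OF ab])
    fix k assume k: "a \<le> k" "k \<le> b"
    have "\<bar>rsum Z a k c d\<bar> \<le> M * sqrt (real (Suc k - a) * real (Suc d - c))"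
      using k cd by (intro rect_boundedD[OF Z]) auto
    also have "\<dots> \<le> M * sqrt (real (Suc b - a) * u)"
      using k M by (intro mult_left_mono real_sqrt_le_mono) (auto simp: u_def intro!: mult_right_mono)
    finally show "\<bar>\<Sum>i\<in>{a..k}. X i\<bar> \<le> M * sqrt (real (Suc b - a) * u)"
      by (simp add: rsum_def X_def)
  qed
  \<comment> \<open>Averaging over the \<open>u\<close> columns gains a factor \<open>1 / u\<close>,
    which turns \<open>sqrt (w * u)\<close> into \<open>sqrt (w / u)\<close> in front of
    \<open>tvv\<close>.\<close>
  have tvF: "tv1 F a b \<le> tvv f a b c d / u"
  proof -
    have "tv1 F a b = (\<Sum>i\<in>{a..<b}. \<bar>\<Sum>j\<in>{c..d}. f (Suc i) j - f i j\<bar> / u)"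
      unfolding tv1_def F_def using u by (simp add: diff_divide_distrib[symmetric] sum_subtractf)
    also have "\<dots> \<le> (\<Sum>i\<in>{a..<b}. (\<Sum>j\<in>{c..d}. \<bar>f (Suc i) j - f i j\<bar>) / u)"
      using u by (intro sum_mono divide_right_mono sum_abs) auto
    also have "\<dots> = tvv f a b c d / u"
      unfolding tvv_def tv1_def sum_divide_distrib[symmetric] by (subst sum.swap) simp
    finally show ?thesis .
  qed
  have 3: "2 * (M * sqrt (w * u)) * tv1 F a b \<le> M * (2 * sqrt (w / u) * tvv f a b c d)"
  proof -
    have "2 * (M * sqrt (w * u)) * tv1 F a b \<le> 2 * (M * sqrt (w * u)) * (tvv f a b c d / u)"
      using M w u by (intro mult_left_mono tvF) auto
    also have "sqrt (w * u) / u = sqrt (w / u)"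
      using w u by (simp add: real_sqrt_mult real_sqrt_divide field_simps)
    then have "2 * (M * sqrt (w * u)) * (tvv f a b c d / u) = M * (2 * sqrt (w / u) * tvv f a b c d)"
      by (simp flip: \<open>sqrt (w * u) / u = sqrt (w / u)\<close>)
    finally show ?thesis .
  qed
  \<comment> \<open>The noise total is at most \<open>M * sqrt (w * u)\<close>, and by
    Cauchy-Schwarz the mean is at most the norm over \<open>sqrt (w * u)\<close>, so the areas
    cancel.\<close>
  have 4: "\<bar>(\<Sum>i\<in>{a..b}. X i) * ?Fm\<bar> \<le> M * sqrt (rsum (\<lambda>i j. (f i j)\<^sup>2) a b c d)"
  proof -
    let ?Q = "sqrt (rsum (\<lambda>i j. (f i j)\<^sup>2) a b c d)"
    have Q: "?Q \<ge> 0" by (simp add: rsum_nonneg)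
    have Fm: "?Fm = rsum f a b c d / (w * u)"
      unfolding F_def rsum_def sum_divide_distrib[symmetric] by (simp add: mult.commute)
    have "\<bar>rsum f a b c d\<bar> \<le> sqrt (w * u) * ?Q"
      unfolding w_def u_def by (rule order_trans[OF abs_rsum_le rsum_abs_le_sqrt])
    then have "\<bar>?Fm\<bar> \<le> sqrt (w * u) * ?Q / (w * u)"
      unfolding Fm using w u by (simp add: divide_right_mono abs_mult)
    moreover have "\<bar>\<Sum>i\<in>{a..b}. X i\<bar> \<le> M * sqrt (w * u)"
      using rect_boundedD[OF Z, of a b c d] ab cd by (simp add: X_def rsum_def w_def u_def)
    ultimately have "\<bar>(\<Sum>i\<in>{a..b}. X i) * ?Fm\<bar> \<le> (M * sqrt (w * u)) * (sqrt (w * u) * ?Q / (w * u))"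
      unfolding abs_mult using M w u Q by (intro mult_mono) auto
    also have "\<dots> = M * ?Q * ((sqrt (w * u))\<^sup>2 / (w * u))"
      by (simp add: power2_eq_square)
    also have "\<dots> = M * ?Q" using w u by (subst real_sqrt_pow2) auto
    finally show ?thesis .
  qed
  from abs_diff_chain[OF abs_diff_chain[OF 1 order_trans[OF 2 3]], of 0] 4
  show ?thesis by (simp add: distrib_left mult.assoc mult.left_commute)
qed

section \<open>Cutting a piece into blocks along its longer side\<close>

lemma sum_split_atLeastAtMost:
  fixes g :: "nat \<Rightarrow> real"
  assumes "c \<le> Suc e" "e \<le> d"
  shows "(\<Sum>j\<in>{c..d}. g j) = (\<Sum>j\<in>{c..e}. g j) + (\<Sum>j\<in>{Suc e..d}. g j)"
  using sum.atLeastLessThan_concat[of c "Suc e" "Suc d" g] assms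
  by (simp add: atLeastLessThanSuc_atLeastAtMost)

lemma rsum_split:
  assumes "c \<le> Suc e" "e \<le> d"
  shows "rsum g a b c d = rsum g a b c e + rsum g a b (Suc e) d"
  unfolding rsum_def sum.distrib[symmetric] by (simp only: sum_split_atLeastAtMost[OF assms])

lemma tvv_split:
  assumes "c \<le> Suc e" "e \<le> d"
  shows "tvv f a b c d = tvv f a b c e + tvv f a b (Suc e) d"
  unfolding tvv_def by (simp only: sum_split_atLeastAtMost[OF assms])

lemma tvh_split:
  assumes "c \<le> e" "e < d"
  shows "tvh f a b c e + tvh f a b (Suc e) d \<le> tvh f a b c d"
  unfolding tvh_def sum.distrib[symmetric]
proof (rule sum_mono)
  fix i
  have "tv1 (f i) (Suc e) d \<le> tv1 (f i) e d" by (rule tv1_mono) auto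
  moreover have "tv1 (f i) c e + tv1 (f i) e d = tv1 (f i) c d"
    using assms by (intro tv1_concat) auto
  ultimately show "tv1 (f i) c e + tv1 (f i) (Suc e) d \<le> tv1 (f i) c d" by simp
qed

text \<open>Blocks of exactly \<open>l\<close> columns are cut off until fewer than
  \<open>2 * l\<close> remain, so every block has length between \<open>l\<close> and
  \<open>2 * l\<close>. The norm of a block does not add up over blocks; it is replaced by
  \<open>(t * Q + 1 / t) / 2\<close>, where \<open>Q\<close> is its square, and the number of blocks
  is counted by length over \<open>l\<close>. The free \<open>t > 0\<close> is tuned once the whole
  norm is known.\<close>

lemma strip_bound:
  fixes Z f :: "nat \<Rightarrow> nat \<Rightarrow> real" and l :: nat
  assumes ab: "a \<le> b" and M: "0 \<le> M" and l: "1 \<le> l" and t: "0 < t"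
  defines "w \<equiv> real (Suc b - a)"
  assumes "l \<le> Suc d - c" "rect_bounded M Z a b c d"
  shows "\<bar>rsum (\<lambda>i j. Z i j * f i j) a b c d\<bar> \<le>
    M * (2 * sqrt (2 * real l) * tvh f a b c d + 2 * sqrt (w / real l) * tvv f a b c d
         + (t * rsum (\<lambda>i j. (f i j)\<^sup>2) a b c d + real (Suc d - c) / (real l * t)) / 2)"
proof -
  define \<Phi> where "\<Phi> c d = 2 * sqrt (2 * real l) * tvh f a b c d + 2 * sqrt (w / real l) * tvv f a b c d
         + (t * rsum (\<lambda>i j. (f i j)\<^sup>2) a b c d + real (Suc d - c) / (real l * t)) / 2" for c d
  have short: "\<bar>rsum (\<lambda>i j. Z i j * f i j) a b c d\<bar> \<le> M * \<Phi> c d"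
    if cd: "l \<le> Suc d - c" "Suc d - c < 2 * l" and Z: "rect_bounded M Z a b c d" for c d
  proof -
    define u where "u = real (Suc d - c)"
    define Q where "Q = rsum (\<lambda>i j. (f i j)\<^sup>2) a b c d"
    have Q: "Q \<ge> 0" by (simp add: Q_def rsum_nonneg)
    have u: "real l \<le> u" "u \<le> 2 * real l"
      unfolding u_def using cd by linarith+
    have l0: "real l > 0" using l by simp
    have "sqrt Q \<le> (t * Q + 1 / t) / 2"
    proof -
      have "0 \<le> (t * sqrt Q - 1)\<^sup>2" by simp
      also have "(t * sqrt Q - 1)\<^sup>2 = t * (t * Q - 2 * sqrt Q + 1 / t)"
        using Q t by (simp add: power2_eq_square algebra_simps)
      finally have "0 \<le> t * Q - 2 * sqrt Q + 1 / t" using t by (simp add: zero_le_mult_iff)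
      then show ?thesis by simp
    qed
    also have "\<dots> \<le> (t * Q + u / (real l * t)) / 2"
      using u l0 t by (simp add: field_simps)
    finally have 1: "sqrt Q \<le> (t * Q + u / (real l * t)) / 2" .
    have 2: "2 * sqrt u * tvh f a b c d \<le> 2 * sqrt (2 * real l) * tvh f a b c d"
      using u by (intro mult_right_mono tvh_nonneg) auto
    have "w / u \<le> w / real l"
      using u l0 by (intro divide_left_mono) (auto simp: w_def)
    then have 3: "2 * sqrt (w / u) * tvv f a b c d \<le> 2 * sqrt (w / real l) * tvv f a b c d"
      by (intro mult_right_mono tvv_nonneg) auto
    have "\<bar>rsum (\<lambda>i j. Z i j * f i j) a b c d\<bar> \<le>
        M * (2 * sqrt u * tvh f a b c d + 2 * sqrt (w / u) * tvv f a b c d + sqrt Q)"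
      unfolding w_def u_def Q_def using cd l ab M Z by (intro block_bound) auto
    also have "\<dots> \<le> M * \<Phi> c d"
      unfolding \<Phi>_def u_def[symmetric] Q_def[symmetric] using 1 2 3 M
      by (intro mult_left_mono add_mono) auto
    finally show ?thesis .
  qed
  have "\<bar>rsum (\<lambda>i j. Z i j * f i j) a b c d\<bar> \<le> M * \<Phi> c d"
    using assms(6,7)
  proof (induction "d - c" arbitrary: c rule: less_induct)
    case less
    show ?case
    proof (cases "Suc d - c < 2 * l")
      case True
      then show ?thesis using less short by blast
    next
      case False
      define e where "e = c + l - 1"
      have e: "c \<le> e" "e < d" "Suc e - c = l" "l \<le> Suc d - Suc e"
        using False l less.prems unfolding e_def by linarith+
      have 1: "\<bar>rsum (\<lambda>i j. Z i j * f i j) a b c e\<bar> \<le> M * \<Phi> c e"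
        using e l by (intro short rect_bounded_mono[OF less.prems(2)]) auto
      have 2: "\<bar>rsum (\<lambda>i j. Z i j * f i j) a b (Suc e) d\<bar> \<le> M * \<Phi> (Suc e) d"
        using e by (intro less.hyps rect_bounded_mono[OF less.prems(2)]) auto
      \<comment> \<open>Every term of \<open>\<Phi>\<close> is additive over the cut except
        \<open>tvh\<close>, which loses the increments between columns \<open>e\<close> and
        \<open>Suc e\<close>.\<close>
      have "\<Phi> c e + \<Phi> (Suc e) d \<le> \<Phi> c d"
      proof -
        have "2 * sqrt (2 * real l) * (tvh f a b c e + tvh f a b (Suc e) d) \<le>
          2 * sqrt (2 * real l) * tvh f a b c d"
          by (intro mult_left_mono tvh_split e) auto
        moreover have "real (Suc d - c) = real (Suc e - c) + real (Suc d - Suc e)"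
          using e by linarith
        then have "real (Suc d - c) / (real l * t) =
            real (Suc e - c) / (real l * t) + real (Suc d - Suc e) / (real l * t)"
          by (simp only: add_divide_distrib)
        moreover have "rsum (\<lambda>i j. (f i j)\<^sup>2) a b c d =
            rsum (\<lambda>i j. (f i j)\<^sup>2) a b c e + rsum (\<lambda>i j. (f i j)\<^sup>2) a b (Suc e) d"
          "tvv f a b c d = tvv f a b c e + tvv f a b (Suc e) d"
          using e by (auto intro: rsum_split tvv_split)
        ultimately show ?thesis
          unfolding \<Phi>_def by (simp only: distrib_left add_divide_distrib)
      qed
      then have "M * \<Phi> c e + M * \<Phi> (Suc e) d \<le> M * \<Phi> c d"
        using mult_left_mono[OF _ M] by (simp only: distrib_left[symmetric])
      then show ?thesis
        using 1 2 rsum_split[of c e d "\<lambda>i j. Z i j * f i j" a b] e by simp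
    qed
  qed
  then show ?thesis by (simp add: \<Phi>_def)
qed

text \<open>This settles the degenerate case of zero norm, in which \<open>f\<close> vanishes on the
  rectangle and the tuning of \<open>t\<close> would divide by zero.\<close>

lemma rsum_mult_eq_0:
  assumes "rsum (\<lambda>i j. (f i j)\<^sup>2) a b c d \<le> 0"
  shows "rsum (\<lambda>i j. Z i j * f i j) a b c d = 0"
proof -
  have "(\<Sum>x\<in>{a..b} \<times> {c..d}. (f (fst x) (snd x))\<^sup>2) \<le> 0"
    using assms by (simp add: rsum_def sum.cartesian_product case_prod_unfold)
  then have "(\<Sum>x\<in>{a..b} \<times> {c..d}. (f (fst x) (snd x))\<^sup>2) = 0"
    by (intro antisym sum_nonneg) auto
  then have "\<forall>x\<in>{a..b} \<times> {c..d}. (f (fst x) (snd x))\<^sup>2 = 0"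
    by (subst (asm) sum_nonneg_eq_0_iff) auto
  then show ?thesis unfolding rsum_def by (intro sum.neutral ballI) force
qed

text \<open>With block length \<open>l\<close> about \<open>sqrt n\<close>, both
  \<open>sqrt l\<close> and \<open>sqrt (u / l)\<close> are of order
  \<open>q = n powr (1/4)\<close>. The weak bound on \<open>tvv\<close> is harmless, since its
  factor \<open>sqrt (u / w)\<close> meets the weight \<open>sqrt (w / l)\<close> and gives
  \<open>sqrt (u / l)\<close>.\<close>

lemma piece_bound_wide:
  fixes Z f :: "nat \<Rightarrow> nat \<Rightarrow> real"
  assumes ab: "a \<le> b" and cd: "c \<le> d" and M: "0 \<le> M" and Z: "rect_bounded M Z a b c d"
  defines "w \<equiv> real (Suc b - a)" and "u \<equiv> real (Suc d - c)"
  assumes wu: "w \<le> u" and un: "u \<le> real n"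
    and s: "0 \<le> s" and \<nu>: "0 \<le> \<nu>" and Q: "rsum (\<lambda>i j. (f i j)\<^sup>2) a b c d \<le> \<nu>\<^sup>2"
    and th: "tvh f a b c d \<le> s + 2 * sqrt (w / u) * \<nu>"
    and tv: "tvv f a b c d \<le> s + 2 * sqrt (u / w) * \<nu>"
  shows "\<bar>rsum (\<lambda>i j. Z i j * f i j) a b c d\<bar> \<le> 14 * M * sqrt (sqrt (real n)) * (s + \<nu>)"
proof (cases "\<nu> = 0")
  case True
  then show ?thesis using Q rsum_mult_eq_0[of f a b c d Z] M s by simp
next
  case False
  then have \<nu>0: "\<nu> > 0" using \<nu> by simp
  define q where "q = sqrt (sqrt (real n))"
  have w1: "w \<ge> 1" and u1: "u \<ge> 1" using ab cd by (auto simp: w_def u_def)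
  have n1: "real n \<ge> 1" using u1 un by linarith
  have q1: "q \<ge> 1" using n1 by (simp add: q_def)
  have q2: "q\<^sup>2 = sqrt (real n)" by (simp add: q_def)
  have q4: "q\<^sup>2 * q\<^sup>2 = real n" by (simp add: q2)
  \<comment> \<open>A piece shorter than \<open>sqrt n\<close> forms a single block.\<close>
  define l where "l = min (Suc d - c) (nat \<lfloor>sqrt (real n)\<rfloor>)"
  have sq1: "sqrt (real n) \<ge> 1" using n1 by simp
  have fl: "real (nat \<lfloor>sqrt (real n)\<rfloor>) \<le> q\<^sup>2" "q\<^sup>2 \<le> 2 * real (nat \<lfloor>sqrt (real n)\<rfloor>)"
  proof -
    have "\<lfloor>sqrt (real n)\<rfloor> \<ge> 1" using sq1 by simp
    then have "real (nat \<lfloor>sqrt (real n)\<rfloor>) = of_int \<lfloor>sqrt (real n)\<rfloor>" "of_int \<lfloor>sqrt (real n)\<rfloor> \<ge> (1 :: real)"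
      by auto
    then show "real (nat \<lfloor>sqrt (real n)\<rfloor>) \<le> q\<^sup>2" "q\<^sup>2 \<le> 2 * real (nat \<lfloor>sqrt (real n)\<rfloor>)"
      unfolding q2 by linarith+
  qed
  have l1: "l \<ge> 1" using cd sq1 by (auto simp: l_def le_nat_iff le_floor_iff)
  have lq: "real l \<le> q\<^sup>2" by (rule order_trans[OF of_nat_mono fl(1)]) (simp add: l_def)
  have ul: "u / real l \<le> 2 * q\<^sup>2"
  proof (cases "l = Suc d - c")
    case True
    then have "u / real l = 1" using l1 by (simp add: u_def)
    also have "1 \<le> 2 * q\<^sup>2" using q2 sq1 by linarith
    finally show ?thesis .
  next
    case False
    then have "l = nat \<lfloor>sqrt (real n)\<rfloor>" by (auto simp: l_def)
    then have "q\<^sup>2 \<le> 2 * real l" using fl by simp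
    then have "q\<^sup>2 * q\<^sup>2 \<le> q\<^sup>2 * (2 * real l)" by (intro mult_left_mono) auto
    then have "u \<le> 2 * q\<^sup>2 * real l" using un q4 by simp
    then show ?thesis using l1 by (simp add: pos_divide_le_eq)
  qed
  have wl: "w / real l \<le> 2 * q\<^sup>2"
    using wu l1 by (intro order_trans[OF _ ul] divide_right_mono) auto
  have sq: "sqrt x \<le> sqrt 2 * q" if "x \<le> 2 * q\<^sup>2" for x
    using real_sqrt_le_mono[OF that] q1 by (simp add: real_sqrt_mult)
  \<comment> \<open>This value balances \<open>t * \<nu>\<^sup>2\<close> against
    \<open>u / (l * t)\<close>; both become \<open>sqrt (u / l) * \<nu>\<close>.\<close>
  define t where "t = sqrt (u / real l) / \<nu>"
  have t: "t > 0" using u1 l1 \<nu>0 by (simp add: t_def)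
  have 1: "2 * sqrt (2 * real l) * tvh f a b c d \<le> 2 * (sqrt 2 * q) * (s + 2 * \<nu>)"
  proof (rule mult_mono)
    show "2 * sqrt (2 * real l) \<le> 2 * (sqrt 2 * q)" using sq[of "2 * real l"] lq by simp
    have "sqrt (w / u) \<le> 1" using wu w1 u1 by simp
    then have "sqrt (w / u) * \<nu> \<le> 1 * \<nu>" using \<nu> by (intro mult_right_mono)
    then show "tvh f a b c d \<le> s + 2 * \<nu>" using th by simp
  qed (use q1 tvh_nonneg in auto)
  have 2: "2 * sqrt (w / real l) * tvv f a b c d \<le> 2 * (sqrt 2 * q) * (s + 2 * \<nu>)"
  proof -
    have e: "sqrt (w / real l) * sqrt (u / w) = sqrt (u / real l)"
      using w1 by (simp add: real_sqrt_mult[symmetric])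
    have "2 * sqrt (w / real l) * tvv f a b c d \<le> 2 * sqrt (w / real l) * (s + 2 * sqrt (u / w) * \<nu>)"
      using w1 by (intro mult_left_mono tv) auto
    also have "\<dots> = 2 * (sqrt (w / real l) * s + 2 * ((sqrt (w / real l) * sqrt (u / w)) * \<nu>))"
      by (simp add: algebra_simps)
    also have "\<dots> = 2 * (sqrt (w / real l) * s + 2 * (sqrt (u / real l) * \<nu>))"
      by (simp only: e)
    also have "\<dots> \<le> 2 * ((sqrt 2 * q) * s + 2 * ((sqrt 2 * q) * \<nu>))"
      using s \<nu> sq[OF wl] sq[OF ul]
      by (intro mult_left_mono add_mono mult_right_mono) auto
    finally show ?thesis by (simp add: algebra_simps)
  qed
  have 3: "(t * rsum (\<lambda>i j. (f i j)\<^sup>2) a b c d + u / (real l * t)) / 2 \<le> sqrt 2 * q * \<nu>"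
  proof -
    have "t * rsum (\<lambda>i j. (f i j)\<^sup>2) a b c d \<le> t * \<nu>\<^sup>2" using t by (intro mult_left_mono Q) auto
    moreover have "t * \<nu>\<^sup>2 = sqrt (u / real l) * \<nu>" using \<nu>0 by (simp add: t_def power2_eq_square)
    moreover have "u / (real l * t) = sqrt (u / real l) * \<nu>"
    proof -
      have "u / (real l * t) = (u / real l) / sqrt (u / real l) * \<nu>" by (simp add: t_def)
      also have "(u / real l) / sqrt (u / real l) = sqrt (u / real l)"
        by (rule real_div_sqrt) (use u1 in auto)
      finally show ?thesis .
    qed
    moreover have "sqrt (u / real l) * \<nu> \<le> sqrt 2 * q * \<nu>"
      using \<nu> sq[OF ul] by (intro mult_right_mono) auto
    ultimately have "t * rsum (\<lambda>i j. (f i j)\<^sup>2) a b c d \<le> sqrt 2 * q * \<nu>" "u / (real l * t) \<le> sqrt 2 * q * \<nu>"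
      by simp_all
    then have "(t * rsum (\<lambda>i j. (f i j)\<^sup>2) a b c d + u / (real l * t)) / 2 \<le>
        (sqrt 2 * q * \<nu> + sqrt 2 * q * \<nu>) / 2"
      by (intro divide_right_mono add_mono) auto
    then show ?thesis by (simp add: mult_ac)
  qed
  have "\<bar>rsum (\<lambda>i j. Z i j * f i j) a b c d\<bar> \<le>
     M * (2 * sqrt (2 * real l) * tvh f a b c d + 2 * sqrt (w / real l) * tvv f a b c d
         + (t * rsum (\<lambda>i j. (f i j)\<^sup>2) a b c d + u / (real l * t)) / 2)"
    unfolding w_def u_def using ab M l1 t Z by (intro strip_bound) (auto simp: l_def)
  also have "\<dots> \<le> M * (2 * (sqrt 2 * q) * (s + 2 * \<nu>) + 2 * (sqrt 2 * q) * (s + 2 * \<nu>) + sqrt 2 * q * \<nu>)"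
    by (rule mult_left_mono[OF add_mono[OF add_mono[OF 1 2] 3] M])
  also have "\<dots> = M * q * (sqrt 2 * (4 * s + 9 * \<nu>))" by (simp add: algebra_simps)
  also have "\<dots> \<le> M * q * (14 * (s + \<nu>))"
  proof (intro mult_left_mono)
    \<comment> \<open>The rational bound \<open>14 / 9\<close> makes the coefficient
      \<open>9 * sqrt 2\<close> of \<open>\<nu>\<close> at most 14; this is the origin of the
      constant 14.\<close>
    have "sqrt 2 \<le> 14 / 9" by (rule real_le_lsqrt) (auto simp: power2_eq_square)
    then have "sqrt 2 * (4 * s + 9 * \<nu>) \<le> 14 / 9 * (4 * s + 9 * \<nu>)"
      using s \<nu> by (intro mult_right_mono) auto
    also have "\<dots> \<le> 14 * (s + \<nu>)" using s by simp
    finally show "sqrt 2 * (4 * s + 9 * \<nu>) \<le> 14 * (s + \<nu>)" .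
  qed (use M q1 in auto)
  finally show ?thesis by (simp add: q_def algebra_simps)
qed

lemma tvh_swap: "tvh (\<lambda>j i. f i j) c d a b = tvv f a b c d"
  by (simp add: tvh_def tvv_def)

lemma tvv_swap: "tvv (\<lambda>j i. f i j) c d a b = tvh f a b c d"
  by (simp add: tvh_def tvv_def)

text \<open>Exchanging rows and columns swaps \<open>tvh\<close> with \<open>tvv\<close> and
  \<open>w\<close> with \<open>u\<close> and preserves all assumptions, so a tall piece is the
  transpose of a wide one.\<close>

lemma piece_bound:
  fixes Z f :: "nat \<Rightarrow> nat \<Rightarrow> real"
  assumes ab: "a \<le> b" and cd: "c \<le> d" and M: "0 \<le> M" and Z: "rect_bounded M Z a b c d"
  defines "w \<equiv> real (Suc b - a)" and "u \<equiv> real (Suc d - c)"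
  assumes wn: "w \<le> real n" and un: "u \<le> real n"
    and s: "0 \<le> s" and \<nu>: "0 \<le> \<nu>" and Q: "rsum (\<lambda>i j. (f i j)\<^sup>2) a b c d \<le> \<nu>\<^sup>2"
    and th: "tvh f a b c d \<le> s + 2 * sqrt (w / u) * \<nu>"
    and tv: "tvv f a b c d \<le> s + 2 * sqrt (u / w) * \<nu>"
  shows "\<bar>rsum (\<lambda>i j. Z i j * f i j) a b c d\<bar> \<le> 14 * M * sqrt (sqrt (real n)) * (s + \<nu>)"
proof (cases "w \<le> u")
  case True
  then show ?thesis
    using assms unfolding w_def u_def by (intro piece_bound_wide[where c = c]) auto
next
  case False
  have "\<bar>rsum (\<lambda>j i. Z i j * f i j) c d a b\<bar> \<le> 14 * M * sqrt (sqrt (real n)) * (s + \<nu>)"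
  proof (rule piece_bound_wide[where Z = "\<lambda>j i. Z i j" and f = "\<lambda>j i. f i j"])
    show "rsum (\<lambda>j i. (f i j)\<^sup>2) c d a b \<le> \<nu>\<^sup>2"
      using Q rsum_swap[of "\<lambda>i j. (f i j)\<^sup>2" c d a b] by simp
    show "real (Suc d - c) \<le> real (Suc b - a)" using False by (simp add: w_def u_def)
    show "tvh (\<lambda>j i. f i j) c d a b \<le> s + 2 * sqrt (real (Suc d - c) / real (Suc b - a)) * \<nu>"
      using tv by (simp only: tvh_swap w_def u_def)
    show "tvv (\<lambda>j i. f i j) c d a b \<le> s + 2 * sqrt (real (Suc b - a) / real (Suc d - c)) * \<nu>"
      using th by (simp only: tvv_swap w_def u_def)
  qed (use ab cd M s \<nu> wn rect_bounded_swap[OF Z] in \<open>auto simp: w_def\<close>)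
  then show ?thesis using rsum_swap[of "\<lambda>i j. Z i j * f i j" c d a b] by simp
qed

section \<open>Whitney pieces of a rectangle\<close>

lemma exists_le_mean:
  fixes h :: "nat \<Rightarrow> real"
  assumes "finite A" "A \<noteq> {}"
  shows "\<exists>t\<in>A. h t \<le> (\<Sum>x\<in>A. h x) / real (card A)"
proof (rule ccontr)
  assume "\<not> ?thesis"
  then have "(\<Sum>x\<in>A. (\<Sum>x\<in>A. h x) / real (card A)) < (\<Sum>x\<in>A. h x)"
    using assms by (intro sum_strict_mono) auto
  then show False using assms by simp
qed

text \<open>A signed boundary value such as \<open>l * g a\<close> can be moved inward to
  \<open>t\<close> at the price of the variation between \<open>a\<close> and \<open>t\<close>,
  which is available in \<open>tv1 g a b\<close>. At \<open>t\<close> it is at least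
  \<open>- \<bar>g t\<bar>\<close>, and the variation between \<open>t\<close> and \<open>t'\<close>
  is left over.\<close>

lemma tv1_interior_bound:
  assumes "a \<le> t" "t \<le> t'" "t' \<le> b" "\<bar>l\<bar> \<le> 1" "\<bar>r\<bar> \<le> 1"
  shows "tv1 g t t' \<le> tv1 g a b + l * g a + r * g b + \<bar>g t\<bar> + \<bar>g t'\<bar>"
proof -
  have key: "- \<bar>y\<bar> \<le> k * x + \<bar>x - y\<bar>" if "\<bar>k\<bar> \<le> 1" for k x y :: real
  proof -
    have "\<bar>k * x\<bar> \<le> 1 * \<bar>x\<bar>" using that unfolding abs_mult by (intro mult_right_mono) auto
    then have "\<bar>k * x - k * y\<bar> \<le> \<bar>x - y\<bar>" "\<bar>k * y\<bar> \<le> \<bar>y\<bar>"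
      using that mult_right_mono[OF that, of "\<bar>x - y\<bar>"] mult_right_mono[OF that, of "\<bar>y\<bar>"]
      by (auto simp: abs_mult right_diff_distrib[symmetric])
    then show ?thesis by linarith
  qed
  have "tv1 g a b = tv1 g a t + tv1 g t t' + tv1 g t' b"
    using assms tv1_concat[of a t b g] tv1_concat[of t t' b g] by simp
  moreover have "\<bar>g a - g t\<bar> \<le> tv1 g a t" "\<bar>g b - g t'\<bar> \<le> tv1 g t' b"
    using assms by (intro abs_diff_le_tv1; simp)+
  ultimately show ?thesis using key[OF assms(4), of "g t" "g a"] key[OF assms(5), of "g t'" "g b"] by linarith
qed

text \<open>The amount by which variation plus signed boundary values exceeds its lower bound, minus
  twice the mean of \<open>\<bar>g\<bar>\<close>. The weights \<open>l\<close> and \<open>r\<close>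
  will be signs of jumps of the true signal at the two ends.\<close>

definition excess :: "(nat \<Rightarrow> real) \<Rightarrow> real \<Rightarrow> real \<Rightarrow> nat \<Rightarrow> nat \<Rightarrow> real" where
  "excess g l r a b = tv1 g a b + l * g a + r * g b + 2 * ((\<Sum>i\<in>{a..b}. \<bar>g i\<bar>) / real (Suc b - a))"

text \<open>The previous bound with \<open>t = t'\<close> at a point where
  \<open>\<bar>g t\<bar>\<close> does not exceed its mean.\<close>

lemma excess_nonneg:
  assumes "a \<le> b" "\<bar>l\<bar> \<le> 1" "\<bar>r\<bar> \<le> 1"
  shows "0 \<le> excess g l r a b"
proof -
  define A where "A = (\<Sum>i\<in>{a..b}. \<bar>g i\<bar>) / real (Suc b - a)"
  obtain t where t: "t \<in> {a..b}" "\<bar>g t\<bar> \<le> A"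
    using exists_le_mean[of "{a..b}" "\<lambda>i. \<bar>g i\<bar>"] assms unfolding A_def by auto
  have "tv1 g t t \<le> tv1 g a b + l * g a + r * g b + \<bar>g t\<bar> + \<bar>g t\<bar>"
    using t assms by (intro tv1_interior_bound) auto
  then show ?thesis using t tv1_nonneg[of g t t] unfolding excess_def A_def[symmetric] by linarith
qed

text \<open>With \<open>w\<close> the number of points of \<open>{p..q}\<close>, the last two
  conditions say that the windows \<open>{Suc p - w..p}\<close> and \<open>{q..q + w - 1}\<close> of
  \<open>w\<close> points each fit into \<open>{a..b}\<close>. This is the Whitney condition that
  the length be at most of the order of the distance to either end.\<close>

definition whitney :: "nat \<Rightarrow> nat \<Rightarrow> nat \<Rightarrow> nat \<Rightarrow> bool" where
  "whitney a b p q \<longleftrightarrow> a \<le> p \<and> p \<le> q \<and> q \<le> b \<and> a + (Suc q - p) \<le> Suc p \<and> q + (Suc q - p) \<le> Suc b"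

text \<open>Each of the two windows contains a point where \<open>\<bar>g\<bar>\<close> is at most
  the mean over the window; the variation between these two points covers
  \<open>{p..q}\<close>.\<close>

lemma tv1_whitney_bound:
  assumes W: "whitney a b p q" and lr: "\<bar>l\<bar> \<le> 1" "\<bar>r\<bar> \<le> 1"
  defines "w \<equiv> Suc q - p"
  shows "tv1 g p q \<le> excess g l r a b +
    ((\<Sum>i\<in>{Suc p - w..p}. \<bar>g i\<bar>) + (\<Sum>i\<in>{q..q + w - 1}. \<bar>g i\<bar>)) / real w"
proof -
  note W' = W[unfolded whitney_def, folded w_def]
  have w: "1 \<le> w" using W' by (auto simp: w_def)
  have c1: "card {Suc p - w..p} = w" and c2: "card {q..q + w - 1} = w" using W' w by auto
  have ne: "{Suc p - w..p} \<noteq> {}" "{q..q + w - 1} \<noteq> {}" using w by auto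
  obtain t where t: "t \<in> {Suc p - w..p}" "\<bar>g t\<bar> \<le> (\<Sum>i\<in>{Suc p - w..p}. \<bar>g i\<bar>) / real w"
    using exists_le_mean[OF _ ne(1), of "\<lambda>i. \<bar>g i\<bar>"] unfolding c1 by blast
  obtain t' where t': "t' \<in> {q..q + w - 1}" "\<bar>g t'\<bar> \<le> (\<Sum>i\<in>{q..q + w - 1}. \<bar>g i\<bar>) / real w"
    using exists_le_mean[OF _ ne(2), of "\<lambda>i. \<bar>g i\<bar>"] unfolding c2 by blast
  have tt: "a \<le> t" "t \<le> p" "q \<le> t'" "t' \<le> b" using t(1) t'(1) W' w by auto
  have "tv1 g p q \<le> tv1 g t t'" using tt by (intro tv1_mono)
  also have "\<dots> \<le> tv1 g a b + l * g a + r * g b + \<bar>g t\<bar> + \<bar>g t'\<bar>"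
    using tt W' lr by (intro tv1_interior_bound) auto
  also have "\<dots> \<le> excess g l r a b + \<bar>g t\<bar> + \<bar>g t'\<bar>"
    unfolding excess_def by (simp add: sum_nonneg)
  finally show ?thesis using t t' by (simp add: add_divide_distrib)
qed

text \<open>Summed over the columns of the piece, each window mean becomes the integral of
  \<open>\<bar>f\<bar>\<close> over a rectangle of the size of the piece, divided by its height;
  Cauchy-Schwarz gives \<open>sqrt (u / w) * \<nu>\<close> for each of the two windows. The excess
  may be summed over all columns because it is nonnegative.\<close>

lemma tvv_whitney_bound:
  fixes f :: "nat \<Rightarrow> nat \<Rightarrow> real"
  assumes W: "whitney a b p q" and rs: "c \<le> r" "r \<le> s" "s \<le> d"
    and lr: "\<And>j. \<bar>L j\<bar> \<le> 1" "\<And>j. \<bar>R j\<bar> \<le> 1"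
  shows "tvv f p q r s \<le> (\<Sum>j\<in>{c..d}. excess (\<lambda>i. f i j) (L j) (R j) a b) +
    2 * sqrt (real (Suc s - r) / real (Suc q - p)) * sqrt (rsum (\<lambda>i j. (f i j)\<^sup>2) a b c d)"
proof -
  note W' = W[unfolded whitney_def]
  define w where "w = Suc q - p"
  define u where "u = Suc s - r"
  define \<nu> where "\<nu> = sqrt (rsum (\<lambda>i j. (f i j)\<^sup>2) a b c d)"
  have w: "1 \<le> w" using W' by (auto simp: w_def)
  have area: "rsum (\<lambda>i j. \<bar>f i j\<bar>) x y r s / real w \<le> sqrt (real u / real w) * \<nu>"
    if xy: "a \<le> x" "y \<le> b" "Suc y - x = w" for x y
  proof -
    have "rsum (\<lambda>i j. \<bar>f i j\<bar>) x y r s \<le> sqrt (real w * real u) * sqrt (rsum (\<lambda>i j. (f i j)\<^sup>2) x y r s)"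
      using rsum_abs_le_sqrt[of f x y r s] xy(3) u_def by simp
    also have "\<dots> \<le> sqrt (real w * real u) * \<nu>"
      unfolding \<nu>_def using xy rs by (intro mult_left_mono real_sqrt_le_mono rsum_mono_rect) auto
    finally have "rsum (\<lambda>i j. \<bar>f i j\<bar>) x y r s / real w \<le> sqrt (real w * real u) * \<nu> / real w"
      by (rule divide_right_mono) simp
    also have "\<dots> = sqrt (real u / real w) * \<nu>"
      using w by (simp add: real_sqrt_mult real_sqrt_divide field_simps)
    finally show ?thesis .
  qed
  have "tvv f p q r s \<le> (\<Sum>j\<in>{r..s}. excess (\<lambda>i. f i j) (L j) (R j) a b +
     ((\<Sum>i\<in>{Suc p - w..p}. \<bar>f i j\<bar>) + (\<Sum>i\<in>{q..q + w - 1}. \<bar>f i j\<bar>)) / real w)"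
    unfolding tvv_def w_def by (intro sum_mono tv1_whitney_bound W lr)
  also have "\<dots> = (\<Sum>j\<in>{r..s}. excess (\<lambda>i. f i j) (L j) (R j) a b) +
     rsum (\<lambda>i j. \<bar>f i j\<bar>) (Suc p - w) p r s / real w + rsum (\<lambda>i j. \<bar>f i j\<bar>) q (q + w - 1) r s / real w"
    unfolding rsum_swap_order by (simp only: sum.distrib add_divide_distrib sum_divide_distrib add.assoc)
  also have "\<dots> \<le> (\<Sum>j\<in>{c..d}. excess (\<lambda>i. f i j) (L j) (R j) a b) +
     sqrt (real u / real w) * \<nu> + sqrt (real u / real w) * \<nu>"
  proof (intro add_mono area)
    show "(\<Sum>j\<in>{r..s}. excess (\<lambda>i. f i j) (L j) (R j) a b) \<le> (\<Sum>j\<in>{c..d}. excess (\<lambda>i. f i j) (L j) (R j) a b)"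
      using rs W' by (intro sum_mono2 excess_nonneg lr) auto
  qed (use W' w in \<open>auto simp: w_def\<close>)
  finally show ?thesis by (simp add: u_def w_def \<nu>_def)
qed

lemma abs_add_le:
  fixes x y :: real
  shows "\<bar>x\<bar> \<le> p \<Longrightarrow> \<bar>y\<bar> \<le> q \<Longrightarrow> \<bar>x + y\<bar> \<le> p + q"
  by linarith

text \<open>Dyadic decomposition towards both ends: from an initial stretch of \<open>h\<close>
  points the outer part beyond \<open>h div 2\<close> is a Whitney interval, and the rest is halved
  again. Each half of \<open>{a..b}\<close> needs at most \<open>k\<close> intervals.\<close>

lemma whitney_sum_bound:
  fixes g :: "nat \<Rightarrow> real"
  assumes ab: "a \<le> b" and k: "Suc b - a < 2 ^ k" and B: "0 \<le> B"
    and W: "\<And>p q. whitney a b p q \<Longrightarrow> \<bar>\<Sum>i\<in>{p..q}. g i\<bar> \<le> B"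
  shows "\<bar>\<Sum>i\<in>{a..b}. g i\<bar> \<le> 2 * real k * B"
proof -
  define m where "m = Suc b - a"
  have m: "Suc b = a + m" using ab by (simp add: m_def)
  have W': "\<bar>\<Sum>i\<in>{p..<q}. g i\<bar> \<le> B" if "a \<le> p" "p < q" "q \<le> a + m" "a + q \<le> Suc p + p" "q + q \<le> Suc a + m + p" for p q
  proof -
    have "whitney a b p (q - 1)" using that m unfolding whitney_def by auto
    moreover have "{p..q - 1} = {p..<q}" using that by auto
    ultimately show ?thesis using W by metis
  qed
  have left: "\<bar>\<Sum>i\<in>{a..<a + h}. g i\<bar> \<le> real k * B" if "h < 2 ^ k" "2 * h \<le> Suc m" for h k
    using that
  proof (induction k arbitrary: h)
    case 0
    then show ?case by simp
  next
    case (Suc k)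
    show ?case
    proof (cases "h = 0")
      case True
      then show ?thesis using B by simp
    next
      case False
      have h: "h div 2 < 2 ^ k" "2 * (h div 2) \<le> Suc m" using Suc.prems by auto
      \<comment> \<open>For odd \<open>h\<close> the new interval has one point more than the rest
        \<open>h div 2\<close>; the offset by one in \<open>whitney\<close> allows exactly
        this.\<close>
      have new: "\<bar>\<Sum>i\<in>{a + h div 2..<a + h}. g i\<bar> \<le> B"
        by (rule W') (use False Suc.prems in linarith)+
      have eq: "(\<Sum>i\<in>{a..<a + h}. g i) = (\<Sum>i\<in>{a..<a + h div 2}. g i) + (\<Sum>i\<in>{a + h div 2..<a + h}. g i)"
        by (rule sum.atLeastLessThan_concat[symmetric]) auto
      from abs_add_le[OF new Suc.IH[OF h]] show ?thesis unfolding eq by (simp add: distrib_right add_ac)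
    qed
  qed
  have right: "\<bar>\<Sum>i\<in>{a + m - h..<a + m}. g i\<bar> \<le> real k * B" if "h < 2 ^ k" "2 * h \<le> Suc m" for h k
    using that
  proof (induction k arbitrary: h)
    case 0
    then show ?case by simp
  next
    case (Suc k)
    show ?case
    proof (cases "h = 0")
      case True
      then show ?thesis using B by simp
    next
      case False
      have h: "h div 2 < 2 ^ k" "2 * (h div 2) \<le> Suc m" using Suc.prems by auto
      have new: "\<bar>\<Sum>i\<in>{a + m - h..<a + m - h div 2}. g i\<bar> \<le> B"
        by (rule W') (use False Suc.prems in linarith)+
      have eq: "(\<Sum>i\<in>{a + m - h..<a + m}. g i) =
          (\<Sum>i\<in>{a + m - h..<a + m - h div 2}. g i) + (\<Sum>i\<in>{a + m - h div 2..<a + m}. g i)"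
        by (rule sum.atLeastLessThan_concat[symmetric]) auto
      from abs_add_le[OF new Suc.IH[OF h]] show ?thesis unfolding eq by (simp add: distrib_right add_ac)
    qed
  qed
  let ?h = "Suc m div 2"
  have h: "a + m - m div 2 = a + ?h" by linarith
  have L: "\<bar>\<Sum>i\<in>{a..<a + ?h}. g i\<bar> \<le> real k * B"
    using k ab by (intro left) (auto simp: m_def)
  have R: "\<bar>\<Sum>i\<in>{a + ?h..<a + m}. g i\<bar> \<le> real k * B"
    using k unfolding h[symmetric] by (intro right) (auto simp: m_def)
  have eq: "(\<Sum>i\<in>{a..b}. g i) = (\<Sum>i\<in>{a..<a + ?h}. g i) + (\<Sum>i\<in>{a + ?h..<a + m}. g i)"
    unfolding atLeastLessThanSuc_atLeastAtMost[symmetric] m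
    by (rule sum.atLeastLessThan_concat[symmetric]) (use ab in \<open>auto simp: m_def\<close>)
  from abs_add_le[OF L R] show ?thesis unfolding eq by (simp add: mult_ac)
qed

text \<open>Whitney decompositions in both directions leave at most \<open>(2 * k)\<^sup>2\<close>
  pieces, each bounded by \<open>K\<close>, and 56 is 4 times 14. The excess sums in both directions
  are nonnegative, so \<open>s\<close> dominates each of them.\<close>

lemma rectangle_bound:
  fixes Z f :: "nat \<Rightarrow> nat \<Rightarrow> real"
  assumes ab: "a \<le> b" and cd: "c \<le> d" and M: "0 \<le> M" and Z: "rect_bounded M Z a b c d"
    and n: "Suc b - a \<le> n" "Suc d - c \<le> n" and k: "n < 2 ^ k"
    and sgn: "\<And>j. \<bar>T j\<bar> \<le> 1" "\<And>j. \<bar>B j\<bar> \<le> 1" "\<And>i. \<bar>L i\<bar> \<le> 1" "\<And>i. \<bar>R i\<bar> \<le> 1"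
  defines "\<nu> \<equiv> sqrt (rsum (\<lambda>i j. (f i j)\<^sup>2) a b c d)"
  defines "s \<equiv> (\<Sum>j\<in>{c..d}. excess (\<lambda>i. f i j) (T j) (B j) a b) + (\<Sum>i\<in>{a..b}. excess (f i) (L i) (R i) c d)"
  shows "\<bar>rsum (\<lambda>i j. Z i j * f i j) a b c d\<bar> \<le> 56 * (real k)\<^sup>2 * M * sqrt (sqrt (real n)) * (s + \<nu>)"
proof -
  have s1: "0 \<le> (\<Sum>j\<in>{c..d}. excess (\<lambda>i. f i j) (T j) (B j) a b)"
    by (intro sum_nonneg excess_nonneg ab sgn)
  have s2: "0 \<le> (\<Sum>i\<in>{a..b}. excess (f i) (L i) (R i) c d)"
    by (intro sum_nonneg excess_nonneg cd sgn)
  have s: "0 \<le> s" using s1 s2 by (simp add: s_def)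
  have \<nu>: "0 \<le> \<nu>" by (simp add: \<nu>_def rsum_nonneg)
  define K where "K = 14 * M * sqrt (sqrt (real n)) * (s + \<nu>)"
  have K: "0 \<le> K" using M s \<nu> by (simp add: K_def)
  have piece: "\<bar>rsum (\<lambda>i j. Z i j * f i j) p q x y\<bar> \<le> K"
    if I: "whitney a b p q" and J: "whitney c d x y" for p q x y
    unfolding K_def
  proof (rule piece_bound)
    note I' = I[unfolded whitney_def] and J' = J[unfolded whitney_def]
    show "p \<le> q" "x \<le> y" using I' J' by auto
    show "rect_bounded M Z p q x y" using I' J' by (intro rect_bounded_mono[OF Z]) auto
    show "real (Suc q - p) \<le> real n" "real (Suc y - x) \<le> real n"
      unfolding of_nat_le_iff using n I' J' by linarith+
    have "rsum (\<lambda>i j. (f i j)\<^sup>2) p q x y \<le> rsum (\<lambda>i j. (f i j)\<^sup>2) a b c d"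
      using I' J' by (intro rsum_mono_rect) auto
    then show "rsum (\<lambda>i j. (f i j)\<^sup>2) p q x y \<le> \<nu>\<^sup>2" by (simp add: \<nu>_def rsum_nonneg)
    show "tvv f p q x y \<le> s + 2 * sqrt (real (Suc y - x) / real (Suc q - p)) * \<nu>"
      using tvv_whitney_bound[of a b p q c x y d T B f, OF I] J' sgn s2 unfolding s_def \<nu>_def by force
    have "tvv (\<lambda>j i. f i j) x y p q \<le> (\<Sum>i\<in>{a..b}. excess (\<lambda>j. f i j) (L i) (R i) c d) +
      2 * sqrt (real (Suc q - p) / real (Suc y - x)) * sqrt (rsum (\<lambda>j i. (f i j)\<^sup>2) c d a b)"
      using I' J sgn by (intro tvv_whitney_bound) auto
    then show "tvh f p q x y \<le> s + 2 * sqrt (real (Suc q - p) / real (Suc y - x)) * \<nu>"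
      unfolding tvv_swap rsum_swap[of "\<lambda>i j. (f i j)\<^sup>2" c d a b] using s1 by (simp add: s_def \<nu>_def)
  qed (use M s \<nu> in auto)
  have col: "\<bar>\<Sum>j\<in>{x..y}. \<Sum>i\<in>{a..b}. Z i j * f i j\<bar> \<le> 2 * real k * K" if J: "whitney c d x y" for x y
  proof -
    have "\<bar>\<Sum>i\<in>{a..b}. \<Sum>j\<in>{x..y}. Z i j * f i j\<bar> \<le> 2 * real k * K"
      by (rule whitney_sum_bound[OF ab _ _ piece[OF _ J, unfolded rsum_def]]) (use n k K in auto)
    then show ?thesis by (subst sum.swap)
  qed
  have "\<bar>\<Sum>j\<in>{c..d}. \<Sum>i\<in>{a..b}. Z i j * f i j\<bar> \<le> 2 * real k * (2 * real k * K)"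
    by (rule whitney_sum_bound[OF cd _ _ col]) (use n k K in auto)
  then show ?thesis
    unfolding K_def rsum_def by (subst sum.swap) (simp add: power2_eq_square algebra_simps)
qed

section \<open>The maximum of the noise over rectangles\<close>

abbreviation gaussian :: "real measure" where
  "gaussian \<equiv> density lborel std_normal_density"

lemma prob_space_gauss_noise: "prob_space (gauss_noise n)"
  unfolding gauss_noise_def by (intro prob_space_PiM prob_space_normal_density) simp

lemma measurable_gauss_noise_component:
  "p \<in> grid n \<Longrightarrow> (\<lambda>\<omega>. \<omega> p) \<in> borel_measurable (gauss_noise n)"
  unfolding gauss_noise_def
  by (subst measurable_cong_sets[OF refl, of borel gaussian]) (auto intro: measurable_component_singleton)

lemma distr_gauss_noise_component:
  assumes "p \<in> grid n"
  shows "distr (gauss_noise n) borel (\<lambda>\<omega>. \<omega> p) = gaussian"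
proof -
  have "distr (gauss_noise n) borel (\<lambda>\<omega>. \<omega> p) = distr (gauss_noise n) gaussian (\<lambda>\<omega>. \<omega> p)"
    by (rule distr_cong) auto
  also have "\<dots> = gaussian"
    unfolding gauss_noise_def
    using distr_PiM_component[of "grid n" "\<lambda>_. gaussian" p] prob_space_normal_density[of 1 0] assms
    by simp
  finally show ?thesis .
qed

text \<open>On the space of the product measure \<open>restrict\<close> is the identity, so the
  joint law of the coordinates is the product of their marginals.\<close>

lemma indep_gauss_noise:
  assumes "grid n \<noteq> {}"
  shows "prob_space.indep_vars (gauss_noise n) (\<lambda>_. borel) (\<lambda>p \<omega>. \<omega> p) (grid n)"
proof -
  interpret prob_space "gauss_noise n" by (rule prob_space_gauss_noise)
  have "distr (gauss_noise n) (Pi\<^sub>M (grid n) (\<lambda>_. borel)) (\<lambda>\<omega>. restrict \<omega> (grid n)) =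
      distr (gauss_noise n) (gauss_noise n) (\<lambda>\<omega>. \<omega>)"
  proof (rule distr_cong)
    show "sets (Pi\<^sub>M (grid n) (\<lambda>_. borel)) = sets (gauss_noise n)"
      unfolding gauss_noise_def by (rule sets_PiM_cong) auto
    show "restrict \<omega> (grid n) = \<omega>" if "\<omega> \<in> space (gauss_noise n)" for \<omega>
      using that unfolding gauss_noise_def space_PiM by (simp add: PiE_restrict)
  qed simp
  also have "\<dots> = (\<Pi>\<^sub>M p\<in>grid n. distr (gauss_noise n) borel (\<lambda>\<omega>. \<omega> p))"
    unfolding distr_id2[OF refl] by (subst gauss_noise_def, rule PiM_cong) (simp_all add: distr_gauss_noise_component)
  finally show ?thesis
    using assms measurable_gauss_noise_component by (subst indep_vars_iff_distr_eq_PiM') auto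
qed

lemma distributed_gauss_noise_sum:
  assumes "A \<subseteq> grid n" "A \<noteq> {}"
  shows "distributed (gauss_noise n) lborel (\<lambda>\<omega>. \<Sum>p\<in>A. \<omega> p) (normal_density 0 (sqrt (real (card A))))"
proof -
  interpret prob_space "gauss_noise n" by (rule prob_space_gauss_noise)
  have fin: "finite A" using assms by (auto simp: grid_def intro: finite_subset)
  have "indep_vars (\<lambda>_. borel) (\<lambda>p \<omega>. \<omega> p) A"
    using assms by (intro indep_vars_subset[OF indep_gauss_noise]) auto
  moreover have "distributed (gauss_noise n) lborel (\<lambda>\<omega>. \<omega> p) (normal_density 0 1)" if "p \<in> A" for p
  proof -
    have "p \<in> grid n" using that assms by auto
    then show ?thesis
      unfolding distributed_def
      by (simp add: distr_gauss_noise_component measurable_gauss_noise_component cong: distr_cong)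
  qed
  ultimately have "distributed (gauss_noise n) lborel (\<lambda>\<omega>. \<Sum>p\<in>A. \<omega> p)
      (normal_density (\<Sum>p\<in>A. 0) (sqrt (\<Sum>p\<in>A. 1\<^sup>2)))"
    using assms fin by (intro sum_indep_normal) auto
  then show ?thesis by simp
qed

text \<open>Multiplying the density of variance \<open>s\<^sup>2\<close> by \<open>exp (x\<^sup>2 / (4 s\<^sup>2))\<close> gives \<open>sqrt 2\<close> times
  the density of variance \<open>2 s\<^sup>2\<close>.\<close>

lemma nn_integral_exp_square_gauss_noise:
  assumes "A \<subseteq> grid n" "A \<noteq> {}"
  shows "(\<integral>\<^sup>+\<omega>. ennreal (exp ((\<Sum>p\<in>A. \<omega> p)\<^sup>2 / (4 * real (card A)))) \<partial>gauss_noise n) = ennreal (sqrt 2)"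
proof -
  have fin: "finite A" using assms by (auto simp: grid_def intro: finite_subset)
  define v where "v = real (card A)"
  have v: "v > 0" using assms fin by (simp add: v_def card_gt_0_iff)
  have dens: "normal_density 0 (sqrt v) x * exp (x\<^sup>2 / (4 * v)) = sqrt 2 * normal_density 0 (sqrt (2 * v)) x" for x
  proof -
    have "exp (- (x\<^sup>2 / (2 * v))) * exp (x\<^sup>2 / (4 * v)) = exp (- (x\<^sup>2 / (2 * (2 * v))))"
      unfolding exp_add[symmetric] using v by (simp add: field_simps)
    moreover have "sqrt (2 * pi * (2 * v)) = sqrt 2 * sqrt (2 * pi * v)"
      by (simp add: real_sqrt_mult)
    ultimately show ?thesis using v by (simp add: normal_density_def field_simps)
  qed
  have "(\<integral>\<^sup>+\<omega>. ennreal (exp ((\<Sum>p\<in>A. \<omega> p)\<^sup>2 / (4 * v))) \<partial>gauss_noise n) =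
      (\<integral>\<^sup>+x. ennreal (normal_density 0 (sqrt v) x) * ennreal (exp (x\<^sup>2 / (4 * v))) \<partial>lborel)"
    using distributed_nn_integral[OF distributed_gauss_noise_sum[OF assms], of "\<lambda>x. ennreal (exp (x\<^sup>2 / (4 * v)))"]
    by (simp add: v_def)
  also have "\<dots> = (\<integral>\<^sup>+x. ennreal (sqrt 2) * ennreal (normal_density 0 (sqrt (2 * v)) x) \<partial>lborel)"
    by (intro nn_integral_cong) (simp add: ennreal_mult[symmetric] dens)
  also have "\<dots> = ennreal (sqrt 2) * (\<integral>\<^sup>+x. ennreal (normal_density 0 (sqrt (2 * v)) x) \<partial>lborel)"
    by (rule nn_integral_cmult) simp
  also have "(\<integral>\<^sup>+x. ennreal (normal_density 0 (sqrt (2 * v)) x) \<partial>lborel) = 1"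
    using v by (subst nn_integral_eq_integral) (auto intro!: integrable_normal_density)
  finally show ?thesis by (simp add: v_def)
qed

section \<open>Union bound over all rectangles of the grid\<close>

definition rectangles :: "nat \<Rightarrow> (nat \<times> nat) set set" where
  "rectangles n = {R. is_rect n R}"

lemma rectangles_subset_image:
  "rectangles n \<subseteq> (\<lambda>((a, b), (c, d)). {a..b} \<times> {c..d}) ` (({1..n} \<times> {1..n}) \<times> ({1..n} \<times> {1..n}))"
  unfolding rectangles_def is_rect_def by force

lemma finite_rectangles: "finite (rectangles n)"
  by (rule finite_subset[OF rectangles_subset_image]) auto

lemma card_rectangles: "card (rectangles n) \<le> n ^ 4"
proof -
  have "card (rectangles n) \<le> card (({1..n} \<times> {1..n}) \<times> ({1..n} \<times> {1..n}))"
    by (rule surj_card_le[OF _ rectangles_subset_image]) auto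
  then show ?thesis by (simp add: card_cartesian_product power4_eq_xxxx mult.assoc)
qed

text \<open>An integrable majorant of the largest value of \<open>(\<Sum>p\<in>R. Z p)\<^sup>2 / card R\<close> over all
  rectangles \<open>R\<close>; it comes from \<open>x \<le> ln K + exp x / K\<close> with \<open>K = n ^ 4\<close>.\<close>

definition max_majorant :: "nat \<Rightarrow> (nat \<times> nat \<Rightarrow> real) \<Rightarrow> real" where
  "max_majorant n Z = 4 * (ln (real n ^ 4) +
     (\<Sum>R\<in>rectangles n. exp ((\<Sum>p\<in>R. Z p)\<^sup>2 / (4 * real (card R)))) / real n ^ 4)"

lemma max_majorant_nonneg: "0 < n \<Longrightarrow> 0 \<le> max_majorant n Z"
  unfolding max_majorant_def by (intro mult_nonneg_nonneg add_nonneg_nonneg divide_nonneg_nonneg sum_nonneg) auto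

lemma abs_sum_le_max_majorant:
  assumes n: "0 < n" and R: "is_rect n R"
  shows "\<bar>\<Sum>p\<in>R. Z p\<bar> \<le> sqrt (max_majorant n Z) * sqrt (real (card R))"
proof -
  have cR: "real (card R) > 0" using R unfolding is_rect_def by (auto simp: card_cartesian_product)
  define x where "x = (\<Sum>p\<in>R. Z p)\<^sup>2 / (4 * real (card R))"
  define K where "K = real n ^ 4"
  have K: "K > 0" using n by (simp add: K_def)
  \<comment> \<open>This gives \<open>x \<le> ln K + exp x / K\<close>; the single exponential is
    then bounded by the sum over all rectangles.\<close>
  have "ln (exp x / K) \<le> exp x / K - 1" using K by (intro ln_le_minus_one) auto
  then have "x \<le> ln K + exp x / K" using K by (simp add: ln_div)
  also have "exp x \<le> (\<Sum>R\<in>rectangles n. exp ((\<Sum>p\<in>R. Z p)\<^sup>2 / (4 * real (card R))))"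
    unfolding x_def using R finite_rectangles
    by (intro member_le_sum[of R "rectangles n" "\<lambda>R. exp ((\<Sum>p\<in>R. Z p)\<^sup>2 / (4 * real (card R)))"])
      (auto simp: rectangles_def)
  finally have "4 * x \<le> max_majorant n Z"
    using K by (simp add: max_majorant_def K_def[symmetric] divide_right_mono)
  then have "(\<Sum>p\<in>R. Z p)\<^sup>2 \<le> max_majorant n Z * real (card R)"
    using cR by (simp add: x_def field_simps)
  then have "sqrt ((\<Sum>p\<in>R. Z p)\<^sup>2) \<le> sqrt (max_majorant n Z * real (card R))"
    by (rule real_sqrt_le_mono)
  then show ?thesis by (simp add: real_sqrt_mult)
qed

lemma rectangles_subset_grid:
  assumes "R \<in> rectangles n"
  shows "R \<subseteq> grid n" "R \<noteq> {}"
  using assms unfolding rectangles_def is_rect_def grid_def by auto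

lemma measurable_exp_square:
  assumes "R \<in> rectangles n"
  shows "(\<lambda>Z. exp ((\<Sum>p\<in>R. Z p)\<^sup>2 / (4 * real (card R)))) \<in> borel_measurable (gauss_noise n)"
proof -
  have "(\<lambda>Z. \<Sum>p\<in>R. Z p) \<in> borel_measurable (gauss_noise n)"
    using rectangles_subset_grid[OF assms]
    by (intro borel_measurable_sum measurable_gauss_noise_component) auto
  then show ?thesis by measurable
qed

lemma measurable_max_majorant: "max_majorant n \<in> borel_measurable (gauss_noise n)"
proof -
  have "(\<lambda>Z. \<Sum>R\<in>rectangles n. exp ((\<Sum>p\<in>R. Z p)\<^sup>2 / (4 * real (card R)))) \<in> borel_measurable (gauss_noise n)"
    by (intro borel_measurable_sum measurable_exp_square)
  then show ?thesis unfolding max_majorant_def by measurable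
qed

text \<open>Every rectangle contributes \<open>sqrt 2\<close>, and there are at most
  \<open>n ^ 4\<close> of them, which the division by \<open>n ^ 4\<close> cancels. The remainder
  \<open>4 * sqrt 2\<close> fits into the 16 supplied by the factor \<open>exp 1\<close> inside the
  logarithm.\<close>

lemma nn_integral_max_majorant:
  assumes n: "0 < n"
  shows "(\<integral>\<^sup>+Z. ennreal (max_majorant n Z) \<partial>gauss_noise n) \<le> ennreal (16 * ln (exp 1 * real n))"
proof -
  interpret prob_space "gauss_noise n" by (rule prob_space_gauss_noise)
  note Rg = rectangles_subset_grid and meas = measurable_exp_square
  have "(\<integral>\<^sup>+Z. ennreal (max_majorant n Z) \<partial>gauss_noise n) =
    (\<integral>\<^sup>+Z. ennreal (4 * ln (real n ^ 4)) + ennreal (4 / real n ^ 4) *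
      (\<Sum>R\<in>rectangles n. ennreal (exp ((\<Sum>p\<in>R. Z p)\<^sup>2 / (4 * real (card R))))) \<partial>gauss_noise n)"
    using n by (intro nn_integral_cong)
      (simp add: max_majorant_def ennreal_plus[symmetric] ennreal_mult[symmetric] sum_nonneg distrib_left del: ennreal_plus)
  also have "\<dots> = ennreal (4 * ln (real n ^ 4)) + ennreal (4 / real n ^ 4) *
      (\<Sum>R\<in>rectangles n. ennreal (sqrt 2))"
    using meas Rg
    by (simp add: nn_integral_add nn_integral_cmult nn_integral_sum emeasure_space_1
        nn_integral_exp_square_gauss_noise del: sum_ennreal)
  also have "\<dots> = ennreal (4 * ln (real n ^ 4) + 4 / real n ^ 4 * (real (card (rectangles n)) * sqrt 2))"
  proof -
    have "(\<Sum>R\<in>rectangles n. ennreal (sqrt 2)) = ennreal (real (card (rectangles n)) * sqrt 2)"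
      by (subst sum_ennreal) auto
    then show ?thesis
      using n by (simp add: ennreal_plus[symmetric] ennreal_mult[symmetric] del: ennreal_plus sum_constant)
  qed
  also have "\<dots> \<le> ennreal (16 * ln (exp 1 * real n))"
  proof (rule ennreal_leI)
    have "real (card (rectangles n)) \<le> real n ^ 4"
      using card_rectangles[of n] by (metis of_nat_le_iff of_nat_power)
    then have "4 / real n ^ 4 * (real (card (rectangles n)) * sqrt 2) \<le> 4 / real n ^ 4 * (real n ^ 4 * sqrt 2)"
      by (intro mult_left_mono mult_right_mono) auto
    also have "\<dots> = 4 * sqrt 2" using n by simp
    also have "\<dots> \<le> 4 * 4"
      by (intro mult_left_mono real_le_lsqrt) auto
    finally show "4 * ln (real n ^ 4) + 4 / real n ^ 4 * (real (card (rectangles n)) * sqrt 2) \<le> 16 * ln (exp 1 * real n)"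
      using n by (simp add: ln_realpow ln_mult)
  qed
  finally show ?thesis .
qed

section \<open>First-order condition for the total variation\<close>

text \<open>The value 0 at index 1 stands for the missing left neighbour at the border of the grid;
  \<open>sgn 0 = 0\<close> makes it vanish wherever \<open>t\<close> does not jump.\<close>

definition jumpL :: "(nat \<Rightarrow> real) \<Rightarrow> nat \<Rightarrow> real" where
  "jumpL t j = (if j \<le> 1 then 0 else sgn (t j - t (j - 1)))"

definition jumpR :: "nat \<Rightarrow> (nat \<Rightarrow> real) \<Rightarrow> nat \<Rightarrow> real" where
  "jumpR n t j = (if n \<le> j then 0 else sgn (t j - t (Suc j)))"

text \<open>The derivative of the one-dimensional total variation at \<open>t\<close> in direction \<open>g\<close>, split into
  contributions of the single points.\<close>

definition tv_deriv :: "nat \<Rightarrow> (nat \<Rightarrow> real) \<Rightarrow> (nat \<Rightarrow> real) \<Rightarrow> nat \<Rightarrow> real" where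
  "tv_deriv n t g j = (if j < n \<and> t (Suc j) = t j then \<bar>g (Suc j) - g j\<bar> else 0)
     + (jumpL t j + jumpR n t j) * g j"

lemma abs_jump_le: "\<bar>jumpL t j\<bar> \<le> 1" "\<bar>jumpR n t j\<bar> \<le> 1"
  by (auto simp: jumpL_def jumpR_def sgn_real_def)

text \<open>Convexity, edge by edge: \<open>\<bar>x + h\<bar> - \<bar>x\<bar>\<close> is at least
  \<open>sgn x * h\<close>, and equals \<open>\<bar>h\<bar>\<close> when \<open>x = 0\<close>. The
  signed contribution of an edge is shared between its two end points, so the \<open>jumpL\<close>
  part has to be shifted by one index.\<close>

lemma sum_tv_deriv_le:
  assumes n: "1 \<le> n"
  shows "(\<Sum>j\<in>{1..n}. tv_deriv n t g j) \<le> tv1 (\<lambda>j. t j + g j) 1 n - tv1 t 1 n"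
proof -
  define F where "F j = (if t (Suc j) = t j then \<bar>g (Suc j) - g j\<bar> else 0)" for j
  have pt: "F j + jumpL t (Suc j) * g (Suc j) + jumpR n t j * g j
      \<le> \<bar>(t (Suc j) + g (Suc j)) - (t j + g j)\<bar> - \<bar>t (Suc j) - t j\<bar>" if "j \<in> {1..<n}" for j
    using that by (auto simp: F_def jumpL_def jumpR_def sgn_real_def)
  have n_eq: "{1..n} = insert n {1..<n}" using n by auto
  have a: "(\<Sum>j\<in>{1..n}. if j < n \<and> t (Suc j) = t j then \<bar>g (Suc j) - g j\<bar> else 0) = (\<Sum>j\<in>{1..<n}. F j)"
    unfolding n_eq by (subst sum.insert) (auto simp: F_def intro: sum.cong)
  have b: "(\<Sum>j\<in>{1..n}. jumpR n t j * g j) = (\<Sum>j\<in>{1..<n}. jumpR n t j * g j)"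
    unfolding n_eq by (subst sum.insert) (auto simp: jumpR_def)
  have "(\<Sum>j\<in>{1..n}. jumpL t j * g j) = (\<Sum>j\<in>{Suc 1..n}. jumpL t j * g j)"
    using n by (subst sum.atLeast_Suc_atMost) (auto simp: jumpL_def)
  also have "\<dots> = (\<Sum>j\<in>{1..<n}. jumpL t (Suc j) * g (Suc j))"
    by (simp only: atLeastLessThanSuc_atLeastAtMost[symmetric] sum.shift_bounds_Suc_ivl)
  finally have c: "(\<Sum>j\<in>{1..n}. jumpL t j * g j) = (\<Sum>j\<in>{1..<n}. jumpL t (Suc j) * g (Suc j))" .
  have "(\<Sum>j\<in>{1..n}. tv_deriv n t g j) = (\<Sum>j\<in>{1..<n}. F j + jumpL t (Suc j) * g (Suc j) + jumpR n t j * g j)"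
    unfolding tv_deriv_def distrib_right sum.distrib a b c by simp
  also have "\<dots> \<le> (\<Sum>j\<in>{1..<n}. \<bar>(t (Suc j) + g (Suc j)) - (t j + g j)\<bar> - \<bar>t (Suc j) - t j\<bar>)"
    by (rule sum_mono[OF pt])
  finally show ?thesis by (simp add: tv1_def sum_subtractf)
qed

text \<open>On a stretch where \<open>t\<close> is constant the inner jumps vanish, so only the left
  jump at \<open>c\<close> and the right jump at \<open>d\<close> survive.\<close>

lemma tv1_boundary_le_sum_tv_deriv:
  assumes cd: "1 \<le> c" "c \<le> d" "d \<le> n" and const: "\<And>j. j \<in> {c..d} \<Longrightarrow> t j = t c"
  shows "tv1 g c d + jumpL t c * g c + jumpR n t d * g d \<le> (\<Sum>j\<in>{c..d}. tv_deriv n t g j)"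
proof -
  have d_eq: "{c..d} = insert d {c..<d}" using cd by auto
  have step: "t (Suc j) = t j" if "j \<in> {c..<d}" for j
    using that const[of j] const[of "Suc j"] by auto
  have "tv1 g c d = (\<Sum>j\<in>{c..<d}. if j < n \<and> t (Suc j) = t j then \<bar>g (Suc j) - g j\<bar> else 0)"
    unfolding tv1_def by (rule sum.cong) (use cd step in auto)
  \<comment> \<open>The added term belongs to the edge leaving the stretch at \<open>d\<close>; it
    can be positive if \<open>t\<close> takes the same value beyond \<open>d\<close>.\<close>
  also have "\<dots> \<le> (\<Sum>j\<in>{c..d}. if j < n \<and> t (Suc j) = t j then \<bar>g (Suc j) - g j\<bar> else 0)"
    by (rule sum_mono2) auto
  finally have a: "tv1 g c d \<le> \<dots>" .
  have b: "(\<Sum>j\<in>{c..d}. jumpR n t j * g j) = jumpR n t d * g d"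
  proof -
    have "(\<Sum>j\<in>{c..<d}. jumpR n t j * g j) = 0"
      by (rule sum.neutral) (use step in \<open>auto simp: jumpR_def\<close>)
    then show ?thesis unfolding d_eq by (subst sum.insert) auto
  qed
  have c: "(\<Sum>j\<in>{c..d}. jumpL t j * g j) = jumpL t c * g c"
  proof -
    have "jumpL t j = 0" if "j \<in> {Suc c..d}" for j
    proof -
      have "j - 1 \<in> {c..<d}" "Suc (j - 1) = j" using that by (simp_all, linarith)
      then have "t j = t (j - 1)" using step[of "j - 1"] by simp
      then show ?thesis by (simp add: jumpL_def)
    qed
    then have "(\<Sum>j\<in>{Suc c..d}. jumpL t j * g j) = 0" by (intro sum.neutral) auto
    then show ?thesis using cd by (subst sum.atLeast_Suc_atMost) auto
  qed
  show ?thesis using a unfolding tv_deriv_def distrib_right sum.distrib b c by simp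
qed

lemma TV_norm_eq:
  "TV_norm n \<theta> = (tvh (\<lambda>i j. \<theta> (i, j)) 1 n 1 n + tvv (\<lambda>i j. \<theta> (i, j)) 1 n 1 n) / real n"
  unfolding TV_norm_def tvh_def tvv_def tv1_def by (subst (3) sum.swap) simp

text \<open>The directional derivative of the unnormalised total variation at
  \<open>\<theta>\<close> along \<open>\<delta>\<close>, distributed over pixels so that it can be
  summed over any partition.\<close>

definition pixel_deriv :: "nat \<Rightarrow> (nat \<times> nat \<Rightarrow> real) \<Rightarrow> (nat \<times> nat \<Rightarrow> real) \<Rightarrow> nat \<times> nat \<Rightarrow> real" where
  "pixel_deriv n \<theta> \<delta> p = tv_deriv n (\<lambda>j. \<theta> (fst p, j)) (\<lambda>j. \<delta> (fst p, j)) (snd p)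
     + tv_deriv n (\<lambda>i. \<theta> (i, snd p)) (\<lambda>i. \<delta> (i, snd p)) (fst p)"

lemma sum_rect_eq: "(\<Sum>p\<in>{a..b} \<times> {c..d}. h p) = rsum (\<lambda>i j. h (i, j)) a b c d"
  by (simp add: rsum_def sum.cartesian_product)

lemma rsum_add: "rsum (\<lambda>i j. f i j + g i j) a b c d = rsum f a b c d + rsum g a b c d"
  by (simp add: rsum_def sum.distrib)

lemma sum_pixel_deriv_nonpos:
  assumes n: "1 \<le> n" and le: "TV_norm n (\<lambda>p. \<theta> p + \<delta> p) \<le> TV_norm n \<theta>"
  shows "(\<Sum>p\<in>grid n. pixel_deriv n \<theta> \<delta> p) \<le> 0"
proof -
  have "(\<Sum>p\<in>grid n. pixel_deriv n \<theta> \<delta> p) =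
    (\<Sum>i\<in>{1..n}. \<Sum>j\<in>{1..n}. tv_deriv n (\<lambda>j. \<theta> (i, j)) (\<lambda>j. \<delta> (i, j)) j) +
    (\<Sum>j\<in>{1..n}. \<Sum>i\<in>{1..n}. tv_deriv n (\<lambda>i. \<theta> (i, j)) (\<lambda>i. \<delta> (i, j)) i)"
    unfolding grid_def sum_rect_eq pixel_deriv_def fst_conv snd_conv rsum_add
      rsum_swap_order[of "\<lambda>i j. tv_deriv n (\<lambda>i. \<theta> (i, j)) (\<lambda>i. \<delta> (i, j)) i"]
    by (simp add: rsum_def)
  also have "\<dots> \<le>
    (\<Sum>i\<in>{1..n}. tv1 (\<lambda>j. \<theta> (i, j) + \<delta> (i, j)) 1 n - tv1 (\<lambda>j. \<theta> (i, j)) 1 n) +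
    (\<Sum>j\<in>{1..n}. tv1 (\<lambda>i. \<theta> (i, j) + \<delta> (i, j)) 1 n - tv1 (\<lambda>i. \<theta> (i, j)) 1 n)"
    by (intro add_mono sum_mono sum_tv_deriv_le n)
  also have "\<dots> = (TV_norm n (\<lambda>p. \<theta> p + \<delta> p) - TV_norm n \<theta>) * real n"
    using n unfolding TV_norm_eq tvh_def tvv_def sum_subtractf by (simp add: field_simps)
  also have "\<dots> \<le> 0" using le by (simp add: mult_nonpos_nonneg)
  finally show ?thesis .
qed

section \<open>Noise on one rectangle and on the whole partition\<close>

lemma rect_noise_bound:
  fixes Z \<theta> \<delta> :: "nat \<times> nat \<Rightarrow> real"
  assumes M: "0 \<le> M" and Z: "rect_bounded M (\<lambda>i j. Z (i, j)) 1 n 1 n" and k: "n < 2 ^ k"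
    and R: "is_rect n R" and const: "const_on \<theta> R" and asp: "aspect R \<le> A"
  shows "\<bar>\<Sum>p\<in>R. Z p * \<delta> p\<bar> \<le> 56 * (real k)\<^sup>2 * M * sqrt (sqrt (real n)) *
    ((\<Sum>p\<in>R. pixel_deriv n \<theta> \<delta> p) + (4 * sqrt A + 1) * sqrt (\<Sum>p\<in>R. (\<delta> p)\<^sup>2))"
proof -
  obtain a b c d where abcd: "1 \<le> a" "a \<le> b" "b \<le> n" "1 \<le> c" "c \<le> d" "d \<le> n" and Req: "R = {a..b} \<times> {c..d}"
    using R unfolding is_rect_def by blast
  define f where "f i j = \<delta> (i, j)" for i j
  define T where "T j = jumpL (\<lambda>i. \<theta> (i, j)) a" for j
  define B where "B j = jumpR n (\<lambda>i. \<theta> (i, j)) b" for j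
  define L where "L i = jumpL (\<lambda>j. \<theta> (i, j)) c" for i
  define S where "S i = jumpR n (\<lambda>j. \<theta> (i, j)) d" for i
  define \<nu> where "\<nu> = sqrt (rsum (\<lambda>i j. (f i j)\<^sup>2) a b c d)"
  define w where "w = real (Suc b - a)"
  define u where "u = real (Suc d - c)"
  have wu: "w > 0" "u > 0" using abcd by (auto simp: w_def u_def)
  have \<nu>: "\<nu> \<ge> 0" by (simp add: \<nu>_def rsum_nonneg)
  have con: "\<theta> p = \<theta> q" if "p \<in> R" "q \<in> R" for p q using const that unfolding const_on_def by blast
  define s where "s = (\<Sum>j\<in>{c..d}. excess (\<lambda>i. f i j) (T j) (B j) a b) + (\<Sum>i\<in>{a..b}. excess (f i) (L i) (S i) c d)"
  have main: "\<bar>rsum (\<lambda>i j. Z (i, j) * f i j) a b c d\<bar> \<le> 56 * (real k)\<^sup>2 * M * sqrt (sqrt (real n)) * (s + \<nu>)"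
    unfolding s_def \<nu>_def using abcd M k
    by (intro rectangle_bound rect_bounded_mono[OF Z]) (auto simp: T_def B_def L_def S_def abs_jump_le)
  define m where "m = rsum (\<lambda>i j. \<bar>f i j\<bar>) a b c d"
  \<comment> \<open>Since \<open>\<theta>\<close> is constant on each column of \<open>R\<close>,
    variation plus signed boundary values is absorbed by the derivative terms; only the mean of
    \<open>\<bar>f\<bar>\<close> remains as a surplus.\<close>
  have "(\<Sum>j\<in>{c..d}. excess (\<lambda>i. f i j) (T j) (B j) a b) \<le>
    (\<Sum>j\<in>{c..d}. (\<Sum>i\<in>{a..b}. tv_deriv n (\<lambda>i. \<theta> (i, j)) (\<lambda>i. \<delta> (i, j)) i) + 2 * ((\<Sum>i\<in>{a..b}. \<bar>f i j\<bar>) / w))"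
    unfolding excess_def w_def f_def T_def B_def using abcd
    by (intro sum_mono add_right_mono tv1_boundary_le_sum_tv_deriv con) (auto simp: Req)
  also have "\<dots> = (\<Sum>j\<in>{c..d}. \<Sum>i\<in>{a..b}. tv_deriv n (\<lambda>i. \<theta> (i, j)) (\<lambda>i. \<delta> (i, j)) i) + 2 * (m / w)"
    unfolding m_def rsum_swap_order by (simp add: sum.distrib sum_distrib_left sum_divide_distrib)
  finally have s1: "(\<Sum>j\<in>{c..d}. excess (\<lambda>i. f i j) (T j) (B j) a b) \<le> \<dots>" .
  have "(\<Sum>i\<in>{a..b}. excess (f i) (L i) (S i) c d) \<le>
    (\<Sum>i\<in>{a..b}. (\<Sum>j\<in>{c..d}. tv_deriv n (\<lambda>j. \<theta> (i, j)) (\<lambda>j. \<delta> (i, j)) j) + 2 * ((\<Sum>j\<in>{c..d}. \<bar>f i j\<bar>) / u))"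
    unfolding excess_def u_def f_def L_def S_def using abcd
    by (intro sum_mono add_right_mono tv1_boundary_le_sum_tv_deriv con) (auto simp: Req)
  also have "\<dots> = (\<Sum>i\<in>{a..b}. \<Sum>j\<in>{c..d}. tv_deriv n (\<lambda>j. \<theta> (i, j)) (\<lambda>j. \<delta> (i, j)) j) + 2 * (m / u)"
    unfolding m_def rsum_def by (simp add: sum.distrib sum_distrib_left sum_divide_distrib)
  finally have s2: "(\<Sum>i\<in>{a..b}. excess (f i) (L i) (S i) c d) \<le> \<dots>" .
  have D: "(\<Sum>p\<in>R. pixel_deriv n \<theta> \<delta> p) =
    (\<Sum>i\<in>{a..b}. \<Sum>j\<in>{c..d}. tv_deriv n (\<lambda>j. \<theta> (i, j)) (\<lambda>j. \<delta> (i, j)) j) +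
    (\<Sum>j\<in>{c..d}. \<Sum>i\<in>{a..b}. tv_deriv n (\<lambda>i. \<theta> (i, j)) (\<lambda>i. \<delta> (i, j)) i)"
    unfolding Req sum_rect_eq pixel_deriv_def fst_conv snd_conv rsum_add
      rsum_swap_order[of "\<lambda>i j. tv_deriv n (\<lambda>i. \<theta> (i, j)) (\<lambda>i. \<delta> (i, j)) i"]
    by (simp add: rsum_def)
  have "nrow R = Suc b - a" "ncol R = Suc d - c"
    using abcd unfolding nrow_def ncol_def Req by auto
  then have asp': "w / u \<le> A" "u / w \<le> A" using asp unfolding aspect_def w_def u_def by auto
  have m: "m \<le> sqrt (w * u) * \<nu>"
    unfolding m_def w_def u_def \<nu>_def by (rule rsum_abs_le_sqrt)
  have mw: "m / w \<le> sqrt A * \<nu>"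
  proof -
    have "m / w \<le> sqrt (w * u) * \<nu> / w" using m wu by (intro divide_right_mono) auto
    also have "\<dots> = sqrt (u / w) * \<nu>" using wu by (simp add: real_sqrt_mult real_sqrt_divide field_simps)
    also have "\<dots> \<le> sqrt A * \<nu>" using asp' \<nu> by (intro mult_right_mono) auto
    finally show ?thesis .
  qed
  have mu: "m / u \<le> sqrt A * \<nu>"
  proof -
    have "m / u \<le> sqrt (w * u) * \<nu> / u" using m wu by (intro divide_right_mono) auto
    also have "\<dots> = sqrt (w / u) * \<nu>" using wu by (simp add: real_sqrt_mult real_sqrt_divide field_simps)
    also have "\<dots> \<le> sqrt A * \<nu>" using asp' \<nu> by (intro mult_right_mono) auto
    finally show ?thesis .
  qed
  \<comment> \<open>The surplus \<open>2 * (m / w) + 2 * (m / u)\<close> is at most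
    \<open>4 * sqrt A * \<nu>\<close>. This is where the aspect ratio enters.\<close>
  have "s + \<nu> \<le> (\<Sum>p\<in>R. pixel_deriv n \<theta> \<delta> p) + (4 * sqrt A + 1) * \<nu>"
    unfolding D s_def using s1 s2 mw mu by (simp add: distrib_right)
  then have "56 * (real k)\<^sup>2 * M * sqrt (sqrt (real n)) * (s + \<nu>) \<le> 56 * (real k)\<^sup>2 * M * sqrt (sqrt (real n)) *
     ((\<Sum>p\<in>R. pixel_deriv n \<theta> \<delta> p) + (4 * sqrt A + 1) * \<nu>)"
    using M by (intro mult_left_mono) auto
  moreover have "(\<Sum>p\<in>R. Z p * \<delta> p) = rsum (\<lambda>i j. Z (i, j) * f i j) a b c d"
    "sqrt (\<Sum>p\<in>R. (\<delta> p)\<^sup>2) = \<nu>"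
    unfolding Req sum_rect_eq \<nu>_def f_def by simp_all
  ultimately show ?thesis using main by simp
qed

lemma sum_grid_partition:
  assumes "rect_partition n P"
  shows "(\<Sum>p\<in>grid n. h p) = (\<Sum>R\<in>P. \<Sum>p\<in>R. h p)"
proof -
  have "\<forall>R\<in>P. finite R" using assms unfolding rect_partition_def is_rect_def by auto
  moreover have "\<forall>R\<in>P. \<forall>S\<in>P. R \<noteq> S \<longrightarrow> R \<inter> S = {}"
    using assms unfolding rect_partition_def pairwise_def disjnt_def by auto
  ultimately have "sum h (\<Union>P) = (sum \<circ> sum) h P" by (rule sum.Union_disjoint)
  then show ?thesis using assms unfolding rect_partition_def by simp
qed

text \<open>The derivative sums over single rectangles may have either sign, but they carry a common
  factor and their total is nonpositive by feasibility. Cauchy-Schwarz over the rectangles then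
  turns the sum of local norms into \<open>sqrt (card P)\<close> times the global norm.\<close>

lemma noise_bound:
  fixes Z \<theta> \<delta> :: "nat \<times> nat \<Rightarrow> real"
  assumes n: "1 \<le> n" and M: "0 \<le> M" and Z: "rect_bounded M (\<lambda>i j. Z (i, j)) 1 n 1 n" and k: "n < 2 ^ k"
    and P: "rect_partition n P" and const: "\<forall>R\<in>P. const_on \<theta> R" and asp: "\<forall>R\<in>P. aspect R \<le> A" and A: "0 \<le> A"
    and le: "TV_norm n (\<lambda>p. \<theta> p + \<delta> p) \<le> TV_norm n \<theta>"
  shows "\<bar>\<Sum>p\<in>grid n. Z p * \<delta> p\<bar> \<le> 56 * (real k)\<^sup>2 * M * sqrt (sqrt (real n)) *
    ((4 * sqrt A + 1) * (sqrt (real (card P)) * sqrt (\<Sum>p\<in>grid n. (\<delta> p)\<^sup>2)))"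
proof -
  let ?K = "56 * (real k)\<^sup>2 * M * sqrt (sqrt (real n))"
  have K: "?K \<ge> 0" using M by simp
  have fin: "finite P" using P by (simp add: rect_partition_def)
  have "\<bar>\<Sum>p\<in>grid n. Z p * \<delta> p\<bar> \<le> (\<Sum>R\<in>P. \<bar>\<Sum>p\<in>R. Z p * \<delta> p\<bar>)"
    unfolding sum_grid_partition[OF P] by (rule sum_abs)
  also have "\<dots> \<le> (\<Sum>R\<in>P. ?K * ((\<Sum>p\<in>R. pixel_deriv n \<theta> \<delta> p) + (4 * sqrt A + 1) * sqrt (\<Sum>p\<in>R. (\<delta> p)\<^sup>2)))"
    using P const asp by (intro sum_mono rect_noise_bound M Z k) (auto simp: rect_partition_def)
  also have "\<dots> = ?K * ((\<Sum>p\<in>grid n. pixel_deriv n \<theta> \<delta> p) + (4 * sqrt A + 1) * (\<Sum>R\<in>P. sqrt (\<Sum>p\<in>R. (\<delta> p)\<^sup>2)))"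
    unfolding sum_grid_partition[OF P] by (simp only: sum_distrib_left sum.distrib distrib_left)
  also have "\<dots> \<le> ?K * (0 + (4 * sqrt A + 1) * (sqrt (real (card P)) * sqrt (\<Sum>p\<in>grid n. (\<delta> p)\<^sup>2)))"
  proof (intro mult_left_mono add_mono K)
    show "(\<Sum>p\<in>grid n. pixel_deriv n \<theta> \<delta> p) \<le> 0" by (rule sum_pixel_deriv_nonpos[OF n le])
    have "(\<Sum>R\<in>P. sqrt (\<Sum>p\<in>R. (\<delta> p)\<^sup>2)) \<le> sqrt (real (card P)) * sqrt (\<Sum>R\<in>P. (sqrt (\<Sum>p\<in>R. (\<delta> p)\<^sup>2))\<^sup>2)"
      using abs_sum_le_sqrt[OF fin, of "\<lambda>R. sqrt (\<Sum>p\<in>R. (\<delta> p)\<^sup>2)"] by (simp add: sum_nonneg)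
    then show "(\<Sum>R\<in>P. sqrt (\<Sum>p\<in>R. (\<delta> p)\<^sup>2)) \<le> sqrt (real (card P)) * sqrt (\<Sum>p\<in>grid n. (\<delta> p)\<^sup>2)"
      unfolding sum_grid_partition[OF P] by (simp add: sum_nonneg)
  qed (use A in auto)
  finally show ?thesis by simp
qed

section \<open>The estimator\<close>

text \<open>A continuous function attains its minimum on a compact set. Off the grid all coordinates
  are fixed to 0, so the relevant arrays lie in a product of compact sets.\<close>

lemma tvd_est_exists:
  assumes V: "0 \<le> V"
  shows "\<exists>\<theta>\<in>tv_ball n V. \<forall>\<theta>'\<in>tv_ball n V. sq_err n y \<theta> \<le> sq_err n y \<theta>'"
proof -
  define B where "B = sq_err n y (\<lambda>_. 0)"
  \<comment> \<open>The ball is unbounded, since it contains all constant arrays on the grid;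
    keeping only arrays at least as good as the zero array confines the grid values to bounded
    intervals.\<close>
  define S where "S = tv_ball n V \<inter> {\<theta>. sq_err n y \<theta> \<le> B}"
  have coord: "continuous_on UNIV (\<lambda>\<theta>::nat \<times> nat \<Rightarrow> real. \<theta> p)" for p
    by (rule continuous_on_product_coordinates)
  have err: "continuous_on UNIV (\<lambda>\<theta>. sq_err n y \<theta>)"
    unfolding sq_err_def by (intro continuous_intros coord)
  have tv: "continuous_on UNIV (\<lambda>\<theta>. TV_norm n \<theta>)"
    unfolding TV_norm_def by (intro continuous_intros coord)
  have "tv_ball n V = (\<Inter>p\<in>- grid n. {\<theta>. \<theta> p = 0}) \<inter> {\<theta>. TV_norm n \<theta> \<le> V}"
    unfolding tv_ball_def by auto
  also have "closed \<dots>"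
    by (intro closed_Int closed_INT ballI closed_Collect_eq closed_Collect_le continuous_on_const coord tv)
  finally have "closed S"
    unfolding S_def by (intro closed_Int closed_Collect_le continuous_on_const err)
  moreover define box where "box = PiE UNIV (\<lambda>p. if p \<in> grid n then {y p - sqrt B..y p + sqrt B} else {0})"
  have "compactin (product_topology (\<lambda>_. euclidean) UNIV) box"
    unfolding box_def compactin_PiE by auto
  then have "compact box"
    by (simp add: euclidean_product_topology)
  moreover have "S \<subseteq> box"
  proof
    fix \<theta> assume \<theta>: "\<theta> \<in> S"
    have "\<theta> p \<in> {y p - sqrt B..y p + sqrt B}" if "p \<in> grid n" for p
    proof -
      have "(y p - \<theta> p)\<^sup>2 \<le> sq_err n y \<theta>"
        unfolding sq_err_def by (rule member_le_sum[OF that]) (auto simp: grid_def)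
      also have "\<dots> \<le> B" using \<theta> by (simp add: S_def)
      finally have "\<bar>y p - \<theta> p\<bar> \<le> sqrt B" using real_le_rsqrt by (simp add: real_le_rsqrt)
      then show ?thesis by auto
    qed
    then show "\<theta> \<in> box" using \<theta> by (auto simp: box_def S_def tv_ball_def)
  qed
  ultimately have "compact S" by (metis compact_Int_closed inf.absorb_iff2)
  moreover have zero: "(\<lambda>_. 0) \<in> S" using V by (simp add: S_def B_def tv_ball_def TV_norm_def)
  ultimately obtain \<theta> where \<theta>: "\<theta> \<in> S" "\<forall>\<theta>'\<in>S. sq_err n y \<theta> \<le> sq_err n y \<theta>'"
    using continuous_attains_inf[of S "\<lambda>\<theta>. sq_err n y \<theta>"] continuous_on_subset[OF err] by blast
  have "sq_err n y \<theta> \<le> sq_err n y \<theta>'" if "\<theta>' \<in> tv_ball n V" for \<theta>'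
    using that \<theta> by (cases "\<theta>' \<in> S") (auto simp: S_def)
  then show ?thesis using \<theta> by (auto simp: S_def)
qed

lemma tvd_est_properties:
  assumes "0 \<le> V"
  shows "tvd_est n V y \<in> tv_ball n V"
    and "\<theta> \<in> tv_ball n V \<Longrightarrow> sq_err n y (tvd_est n V y) \<le> sq_err n y \<theta>"
proof -
  have "\<exists>\<theta>. \<theta> \<in> tv_ball n V \<and> (\<forall>\<theta>'\<in>tv_ball n V. sq_err n y \<theta> \<le> sq_err n y \<theta>')"
    using tvd_est_exists[OF assms] by blast
  from someI_ex[OF this] show "tvd_est n V y \<in> tv_ball n V"
    and "\<theta> \<in> tv_ball n V \<Longrightarrow> sq_err n y (tvd_est n V y) \<le> sq_err n y \<theta>"
    unfolding tvd_est_def by auto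
qed

lemma rect_bounded_max_majorant:
  assumes "0 < n"
  shows "rect_bounded (sqrt (max_majorant n Z)) (\<lambda>i j. Z (i, j)) 1 n 1 n"
  unfolding rect_bounded_def
proof (intro allI impI)
  fix p q r s assume "1 \<le> p" "p \<le> q" "q \<le> n" "1 \<le> r" "r \<le> s" "s \<le> n"
  then have "is_rect n ({p..q} \<times> {r..s})" unfolding is_rect_def by blast
  from abs_sum_le_max_majorant[OF assms this, of Z]
  show "\<bar>rsum (\<lambda>i j. Z (i, j)) p q r s\<bar> \<le> sqrt (max_majorant n Z) * sqrt (real (Suc q - p) * real (Suc s - r))"
    unfolding sum_rect_eq by (simp only: card_cartesian_product card_atLeastAtMost of_nat_mult)
qed

lemma TV_norm_nonneg: "0 \<le> TV_norm n \<theta>"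
  unfolding TV_norm_eq by (simp add: tvh_nonneg tvv_nonneg)

text \<open>For every fixed \<open>Z\<close>, minimality and the noise bound give
  \<open>D\<^sup>2 \<le> 2 * \<sigma> * K * D\<close>; cancelling \<open>D\<close> and squaring
  yields the claim, with 112 as twice 56.\<close>

lemma tvd_est_error_bound:
  fixes Z \<theta> :: "nat \<times> nat \<Rightarrow> real"
  assumes n: "1 \<le> n" and \<sigma>: "0 < \<sigma>" and k: "n < 2 ^ k"
    and P: "rect_partition n P" and const: "\<forall>R\<in>P. const_on \<theta> R" and asp: "\<forall>R\<in>P. aspect R \<le> A" and A: "0 \<le> A"
  shows "sq_err n (tvd_est n (TV_norm n \<theta>) (\<lambda>p. \<theta> p + \<sigma> * Z p)) \<theta> \<le>
    (112 * \<sigma> * (real k)\<^sup>2 * (4 * sqrt A + 1))\<^sup>2 * sqrt (real n) * real (card P) * max_majorant n Z"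
proof -
  define e where "e = tvd_est n (TV_norm n \<theta>) (\<lambda>p. \<theta> p + \<sigma> * Z p)"
  define \<delta> where "\<delta> p = e p - \<theta> p" for p
  \<comment> \<open>Members of \<open>tv_ball\<close> vanish off the grid while
    \<open>\<theta>\<close> is arbitrary there; \<open>\<theta>0\<close> is the feasible competitor
    that agrees with \<open>\<theta>\<close> on the grid.\<close>
  define \<theta>0 where "\<theta>0 p = (if p \<in> grid n then \<theta> p else 0)" for p
  define D where "D = sqrt (\<Sum>p\<in>grid n. (\<delta> p)\<^sup>2)"
  have D0: "D \<ge> 0" by (simp add: D_def sum_nonneg)
  have D2: "D\<^sup>2 = (\<Sum>p\<in>grid n. (\<delta> p)\<^sup>2)" by (simp add: D_def sum_nonneg)
  have "TV_norm n \<theta>0 = TV_norm n \<theta>"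
    unfolding TV_norm_def
    by (intro arg_cong2[where f = "(*)"] arg_cong2[where f = "(+)"] refl sum.cong)
      (auto simp: \<theta>0_def grid_def)
  then have "\<theta>0 \<in> tv_ball n (TV_norm n \<theta>)" by (simp add: tv_ball_def \<theta>0_def)
  then have "sq_err n (\<lambda>p. \<theta> p + \<sigma> * Z p) e \<le> sq_err n (\<lambda>p. \<theta> p + \<sigma> * Z p) \<theta>0"
    unfolding e_def by (intro tvd_est_properties TV_norm_nonneg)
  also have "\<dots> = (\<Sum>p\<in>grid n. (\<sigma> * Z p)\<^sup>2)" unfolding sq_err_def by (rule sum.cong) (auto simp: \<theta>0_def)
  also have "sq_err n (\<lambda>p. \<theta> p + \<sigma> * Z p) e = (\<Sum>p\<in>grid n. (\<sigma> * Z p)\<^sup>2 - 2 * \<sigma> * (Z p * \<delta> p) + (\<delta> p)\<^sup>2)"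
    unfolding sq_err_def \<delta>_def by (rule sum.cong) (auto simp: power2_eq_square algebra_simps)
  also have "\<dots> = (\<Sum>p\<in>grid n. (\<sigma> * Z p)\<^sup>2) - 2 * \<sigma> * (\<Sum>p\<in>grid n. Z p * \<delta> p) + D\<^sup>2"
    unfolding D2 by (simp add: sum.distrib sum_subtractf sum_distrib_left)
  finally have basic: "D\<^sup>2 \<le> 2 * \<sigma> * (\<Sum>p\<in>grid n. Z p * \<delta> p)" by simp
  have le: "TV_norm n (\<lambda>p. \<theta> p + \<delta> p) \<le> TV_norm n \<theta>"
    using tvd_est_properties(1)[OF TV_norm_nonneg[of n \<theta>], of n "\<lambda>p. \<theta> p + \<sigma> * Z p"] by (simp add: \<delta>_def e_def tv_ball_def)
  define G where "G = max_majorant n Z"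
  have G: "0 \<le> G" using n by (simp add: G_def max_majorant_nonneg)
  define K where "K = 56 * (real k)\<^sup>2 * sqrt G * sqrt (sqrt (real n)) * ((4 * sqrt A + 1) * sqrt (real (card P)))"
  have K: "0 \<le> K" using G A by (simp add: K_def)
  have "\<bar>\<Sum>p\<in>grid n. Z p * \<delta> p\<bar> \<le> 56 * (real k)\<^sup>2 * sqrt G * sqrt (sqrt (real n)) *
      ((4 * sqrt A + 1) * (sqrt (real (card P)) * D))"
    unfolding D_def G_def using n G
    by (intro noise_bound[OF n _ _ k P const asp A le] rect_bounded_max_majorant) (auto simp: G_def)
  then have noise: "(\<Sum>p\<in>grid n. Z p * \<delta> p) \<le> K * D" by (simp add: K_def mult.assoc)
  have "D * D \<le> (2 * \<sigma> * K) * D"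
    using order_trans[OF basic mult_left_mono[OF noise]] \<sigma> by (simp add: power2_eq_square mult.assoc)
  then have "D \<le> 2 * \<sigma> * K" using D0 \<sigma> K by (cases "D = 0") auto
  then have "D\<^sup>2 \<le> (2 * \<sigma> * K)\<^sup>2" using D0 by (rule power_mono)
  also have "\<dots> = (112 * \<sigma> * (real k)\<^sup>2 * (4 * sqrt A + 1))\<^sup>2 * sqrt (real n) * real (card P) * G"
    unfolding K_def power_mult_distrib using G by (simp add: field_simps)
  finally show ?thesis unfolding D2 sq_err_def \<delta>_def e_def G_def .
qed

section \<open>Expectation and final constants\<close>

lemma ex_power2_gt_le_ln:
  assumes n: "1 \<le> n"
  shows "\<exists>k. n < 2 ^ k \<and> real k \<le> 2 * ln (exp 1 * real n)"
proof -
  obtain m where m: "2 ^ m \<le> n" "n < 2 ^ (m + 1)" using ex_power_ivl1[of 2 n] n by auto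
  have "real m * ln 2 = ln (2 ^ m)" by (simp add: ln_realpow)
  also have "\<dots> \<le> ln (real n)"
  proof -
    have "(2::real) ^ m \<le> real n" using m(1) by (metis of_nat_le_iff of_nat_numeral of_nat_power)
    then show ?thesis using n by simp
  qed
  finally have "real m * ln 2 \<le> ln (real n)" .
  \<comment> \<open>The crude bound \<open>1 / 2\<close> for \<open>ln 2\<close> gives
    \<open>m \<le> 2 * ln n\<close>; the step from \<open>m\<close> to \<open>m + 1\<close> is paid
    by \<open>2 * ln (exp 1) = 2\<close>.\<close>
  moreover have "real m * (1 / 2) \<le> real m * ln 2"
    using ln2_ge_two_thirds by (intro mult_left_mono) auto
  ultimately have "real (m + 1) \<le> 2 * ln (exp 1 * real n)" using n by (simp add: ln_mult)
  then show ?thesis using m by blast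
qed

theorem theorem2p2:
  fixes c :: real
  assumes "c > 0"
  shows "\<exists>C>0. \<forall>(n::nat) (\<sigma>::real) (\<theta>::nat \<times> nat \<Rightarrow> real) P.
           n \<ge> 1 \<longrightarrow> \<sigma> > 0 \<longrightarrow>
           rect_partition n P \<longrightarrow> (\<forall>R\<in>P. const_on \<theta> R) \<longrightarrow> card P = k_rect n \<theta> \<longrightarrow>
           (\<forall>R\<in>P. aspect R \<le> c) \<longrightarrow>
           MSE n (TV_norm n \<theta>) \<sigma> \<theta> \<le>
             ennreal (C * \<sigma>\<^sup>2 * (ln (exp 1 * real n)) ^ 9 *
                      real (k_rect n \<theta>) powr (5/4) / real (n\<^sup>2) powr (3/4))"
proof -
  define B where "B = (112 * (4 * sqrt c + 1))\<^sup>2"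
  have "sqrt c \<ge> 0" using assms by simp
  then have B: "B > 0" unfolding B_def by (intro zero_less_power mult_pos_pos add_nonneg_pos) auto
  have bound: "MSE n (TV_norm n \<theta>) \<sigma> \<theta> \<le>
       ennreal (256 * B * \<sigma>\<^sup>2 * (ln (exp 1 * real n)) ^ 9 * real (card P) powr (5/4) / real (n\<^sup>2) powr (3/4))"
    if n: "n \<ge> 1" and \<sigma>: "\<sigma> > 0" and P: "rect_partition n P" and const: "\<forall>R\<in>P. const_on \<theta> R"
      and asp: "\<forall>R\<in>P. aspect R \<le> c" for n \<sigma> \<theta> P
  proof -
    define \<Lambda> where "\<Lambda> = ln (exp 1 * real n)"
    have \<Lambda>: "\<Lambda> \<ge> 1" using n by (simp add: \<Lambda>_def ln_mult)
    obtain k where k: "n < 2 ^ k" "real k \<le> 2 * \<Lambda>" using ex_power2_gt_le_ln[OF n] unfolding \<Lambda>_def by blast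
    define W where "W = B * \<sigma>\<^sup>2 * real k ^ 4 * sqrt (real n) * real (card P)"
    have W: "W \<ge> 0" using B by (simp add: W_def)
    have Weq: "W = (112 * \<sigma> * (real k)\<^sup>2 * (4 * sqrt c + 1))\<^sup>2 * sqrt (real n) * real (card P)"
    proof -
      have "((real k)\<^sup>2)\<^sup>2 = real k ^ 4" by (subst power_mult[symmetric]) simp
      then show ?thesis unfolding W_def B_def power_mult_distrib by (simp only: mult_ac)
    qed
    have card: "card P \<ge> 1"
    proof -
      have "grid n \<noteq> {}" using n by (simp add: grid_def)
      then have "P \<noteq> {}" "finite P" using P unfolding rect_partition_def by auto
      then show ?thesis by (simp add: Suc_leI card_gt_0_iff)
    qed
    have "(\<integral>\<^sup>+ Z. ennreal (sq_err n (tvd_est n (TV_norm n \<theta>) (\<lambda>p. \<theta> p + \<sigma> * Z p)) \<theta>) \<partial>gauss_noise n)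
      \<le> (\<integral>\<^sup>+ Z. ennreal W * ennreal (max_majorant n Z) \<partial>gauss_noise n)"
    \<comment> \<open>The integrands are compared pointwise, so measurability is only asked of the
      majorant.\<close>
    proof (rule nn_integral_mono)
      fix Z
      have "sq_err n (tvd_est n (TV_norm n \<theta>) (\<lambda>p. \<theta> p + \<sigma> * Z p)) \<theta> \<le> W * max_majorant n Z"
        unfolding Weq using assms by (intro tvd_est_error_bound n \<sigma> k P const asp) auto
      then show "ennreal (sq_err n (tvd_est n (TV_norm n \<theta>) (\<lambda>p. \<theta> p + \<sigma> * Z p)) \<theta>) \<le>
          ennreal W * ennreal (max_majorant n Z)"
        using W n by (subst ennreal_mult[symmetric]) (auto intro!: ennreal_leI max_majorant_nonneg)
    qed
    also have "\<dots> = ennreal W * (\<integral>\<^sup>+ Z. ennreal (max_majorant n Z) \<partial>gauss_noise n)"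
      using measurable_max_majorant[of n] by (intro nn_integral_cmult) measurable
    also have "\<dots> \<le> ennreal W * ennreal (16 * \<Lambda>)"
      unfolding \<Lambda>_def using n by (intro mult_left_mono nn_integral_max_majorant) auto
    also have "\<dots> = ennreal (W * (16 * \<Lambda>))" using W \<Lambda> by (simp add: ennreal_mult)
    finally have "MSE n (TV_norm n \<theta>) \<sigma> \<theta> \<le> ennreal (W * (16 * \<Lambda>)) / ennreal (real (n\<^sup>2))"
      unfolding MSE_def by (rule divide_right_mono_ennreal)
    also have "\<dots> = ennreal (W * (16 * \<Lambda>) / real (n\<^sup>2))"
      using W \<Lambda> n by (intro divide_ennreal) auto
    also have "\<dots> \<le> ennreal (256 * B * \<sigma>\<^sup>2 * \<Lambda> ^ 9 * real (card P) powr (5/4) / real (n\<^sup>2) powr (3/4))"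
    proof (rule ennreal_leI)
      \<comment> \<open>The factor 256 is \<open>2 ^ 4 * 16\<close>. The four powers of
        \<open>k\<close> and the one from the expectation make \<open>\<Lambda> ^ 5\<close>, which
        \<open>\<Lambda> \<ge> 1\<close> raises to \<open>\<Lambda> ^ 9\<close>.\<close>
      have "real k ^ 4 \<le> (2 * \<Lambda>) ^ 4" using k by (intro power_mono) auto
      then have "real k ^ 4 * (16 * \<Lambda>) \<le> (2 * \<Lambda>) ^ 4 * (16 * \<Lambda>)" using \<Lambda> by (intro mult_right_mono) auto
      also have "\<dots> = 256 * \<Lambda> ^ 5" by (simp add: power_mult_distrib power_Suc2[symmetric] flip: power_Suc)
      also have "\<dots> \<le> 256 * \<Lambda> ^ 9" using \<Lambda> by (intro mult_left_mono power_increasing) auto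
      finally have 1: "real k ^ 4 * (16 * \<Lambda>) \<le> 256 * \<Lambda> ^ 9" .
      have 2: "real (card P) \<le> real (card P) powr (5/4)"
        using powr_mono[of 1 "5/4" "real (card P)"] card by simp
      have n0: "real n > 0" using n by simp
      \<comment> \<open>With \<open>N = n\<^sup>2\<close>, the quotient \<open>sqrt n / N\<close> is
        \<open>n powr (-3/2)\<close>, that is \<open>N powr (-3/4)\<close>.\<close>
      have n2: "real (n\<^sup>2) = real n powr 2" using n0 by simp
      have "real (n\<^sup>2) powr (3/4) = real n powr (3/2)"
        unfolding n2 powr_powr by simp
      moreover have "sqrt (real n) = real n powr (1/2)" using n0 by (simp add: powr_half_sqrt)
      moreover have "real (n\<^sup>2) = real n powr (1/2) * real n powr (3/2)"
        unfolding n2 powr_add[symmetric] by simp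
      ultimately have 3: "sqrt (real n) / real (n\<^sup>2) = 1 / real (n\<^sup>2) powr (3/4)" using n0 by simp
      have "W * (16 * \<Lambda>) / real (n\<^sup>2) = (B * \<sigma>\<^sup>2) * ((real k ^ 4 * (16 * \<Lambda>)) * real (card P)) * (sqrt (real n) / real (n\<^sup>2))"
        by (simp add: W_def)
      also have "\<dots> \<le> (B * \<sigma>\<^sup>2) * ((256 * \<Lambda> ^ 9) * real (card P) powr (5/4)) * (sqrt (real n) / real (n\<^sup>2))"
        using B \<Lambda> by (intro mult_right_mono mult_left_mono mult_mono 1 2) auto
      also have "\<dots> = 256 * B * \<sigma>\<^sup>2 * \<Lambda> ^ 9 * real (card P) powr (5/4) / real (n\<^sup>2) powr (3/4)"
        unfolding 3 by (simp add: mult_ac)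
      finally show "W * (16 * \<Lambda>) / real (n\<^sup>2) \<le> 256 * B * \<sigma>\<^sup>2 * \<Lambda> ^ 9 * real (card P) powr (5/4) / real (n\<^sup>2) powr (3/4)" .
    qed
    finally show ?thesis unfolding \<Lambda>_def .
  qed
  show ?thesis
  proof (intro exI[of _ "256 * B"] conjI allI impI)
    fix n :: nat and \<sigma> :: real and \<theta> :: "nat \<times> nat \<Rightarrow> real" and P
    assume "1 \<le> n" "0 < \<sigma>" "rect_partition n P" "\<forall>R\<in>P. const_on \<theta> R" "card P = k_rect n \<theta>" "\<forall>R\<in>P. aspect R \<le> c"
    then show "MSE n (TV_norm n \<theta>) \<sigma> \<theta> \<le> ennreal (256 * B * \<sigma>\<^sup>2 * (ln (exp 1 * real n)) ^ 9 *
        real (k_rect n \<theta>) powr (5/4) / real (n\<^sup>2) powr (3/4))"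
      using bound[of n \<sigma> P \<theta>] by simp
  qed (use B in simp)
qed

end
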